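(* There are constants $0<c<C$ such that for each $\sigma>0$: (a) for all $n\ge 1$, $$\lambda_n(\sigma)-\lambda_n(0)\le C\,\lambda_n(0)^{1/4}\cdot\sigma;$$ (b) there are arbitrarily large $n$ such that $$\lambda_n(\sigma)-\lambda_n(0)\ge c\,\lambda_n(0)^{1/4}\cdot\sigma .$$
   Context: Let $\Omega$ be the closed upper unit hemisphere in $\mathbb R^3$ with coordinates $(\sin\theta\cos\phi,\sin\theta\sin\phi,\cos\theta)$, $0\le\theta\le\pi/2$, $0\le \phi<2\pi$, and boundary the equator $\theta=\pi/2$. For a constant $\sigma\ge0$ the Robin problem is $\Delta F+\lambda F=0$ in $\Omega$, $\frac{\partial F}{\partial n}+\sigma F=0$ on $\partial\Omega$, where $\Delta$ is the Laplace-Beltrami operator and $\partial/\partial n$ the outward normal derivative ($\sigma=0$ is the Neumann problem). It separates into sectors of functions $F=e^{im\phi}f(\cos\theta)$, $m\in\mathbb Z$; since $\pm m$ give the same eigenvalues, the desymmetrized spectrum keeps only the eigenvalues of sectors with $m\ge0$ (an eigenvalue is counted once for each $m\ge 0$ for which it has a nonzero eigenfunction in sector $m$). Let $\lambda_0(\sigma)\le\lambda_1(\sigma)\le\cdots$ be the ordered desymmetrized Robin eigenvalues, repeated with multiplicity, and let $\lambda_0(0)=0<\lambda_1(0)=2<\lambda_2(0)=\lambda_3(0)=6<\cdots$ be the ordered desymmetrized Neumann eigenvalues, where $\ell(\ell+1)$ ($\ell\ge 0$ integer) has multiplicity $\lfloor \ell/2\rfloor+1$. *)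

theory Defs
  imports "HOL-Analysis.Analysis"
begin

definition pderiv_at :: "'n::finite \<Rightarrow> (real^'n \<Rightarrow> complex) \<Rightarrow> real^'n \<Rightarrow> complex"
  where "pderiv_at i G x = frechet_derivative G (at x) (axis i 1)"

text \<open>The following two predicates are meant for open \<open>U\<close>.\<close>

definition C1_on :: "(real^'n::finite) set \<Rightarrow> (real^'n \<Rightarrow> complex) \<Rightarrow> bool"
  where "C1_on U G \<longleftrightarrow> G differentiable_on U \<and> (\<forall>i. continuous_on U (pderiv_at i G))"

definition C2_on :: "(real^'n::finite) set \<Rightarrow> (real^'n \<Rightarrow> complex) \<Rightarrow> bool"
  where "C2_on U G \<longleftrightarrow> C1_on U G \<and> (\<forall>i. C1_on U (pderiv_at i G))"

definition laplacian :: "(real^'n::finite \<Rightarrow> complex) \<Rightarrow> real^'n \<Rightarrow> complex"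
  where "laplacian G x = (\<Sum>i\<in>UNIV. pderiv_at i (pderiv_at i G) x)"

definition sph :: "real \<Rightarrow> real \<Rightarrow> real^3"
  where "sph \<theta> \<phi> = vector [sin \<theta> * cos \<phi>, sin \<theta> * sin \<phi>, cos \<theta>]"

definition hemisphere :: "(real^3) set"
  where "hemisphere = {x. norm x = 1 \<and> 0 \<le> x $ 3}"

definition open_hemisphere :: "(real^3) set"
  where "open_hemisphere = {x. norm x = 1 \<and> 0 < x $ 3}"

definition hom_ext :: "(real^3 \<Rightarrow> complex) \<Rightarrow> real^3 \<Rightarrow> complex"
  where "hom_ext F x = F (x /\<^sub>R norm x)"

text \<open>
  The Laplace--Beltrami operator of the unit sphere is the Euclidean Laplacian of the extension
  that is constant along rays, evaluated on the sphere. In contrast to the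
  formula in the coordinates \<open>\<theta>\<close>, \<open>\<phi>\<close>, this also makes sense at the north pole.
\<close>

definition laplace_beltrami :: "(real^3 \<Rightarrow> complex) \<Rightarrow> real^3 \<Rightarrow> complex"
  where "laplace_beltrami F x = laplacian (hom_ext F) x"

text \<open>
  Classical solutions: continuous on the closed hemisphere and twice continuously differentiable
  in its interior (that is, the extension along rays is \<open>C\<^sup>2\<close> on the open upper half-space).
  On the equator the outward unit normal is the direction of increasing \<open>\<theta>\<close>,
  so the outward normal derivative is the one-sided \<open>\<theta>\<close>-derivative at \<open>\<theta> = \<pi>/2\<close>; it is required to
  exist and to equal \<open>- \<sigma> F\<close>.
\<close>

definition robin_solution :: "real \<Rightarrow> real \<Rightarrow> (real^3 \<Rightarrow> complex) \<Rightarrow> bool"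
  where "robin_solution \<sigma> \<mu> F \<longleftrightarrow>
    continuous_on hemisphere F \<and>
    C2_on {x. 0 < x $ 3} (hom_ext F) \<and>
    (\<forall>x\<in>open_hemisphere. laplace_beltrami F x + of_real \<mu> * F x = 0) \<and>
    (\<forall>\<phi>. \<exists>D. ((\<lambda>\<theta>. F (sph \<theta> \<phi>)) has_vector_derivative D) (at (pi/2) within {0..pi/2}) \<and>
             D + of_real \<sigma> * F (sph (pi/2) \<phi>) = 0)"

definition in_sector :: "int \<Rightarrow> (real^3 \<Rightarrow> complex) \<Rightarrow> bool"
  where "in_sector m F \<longleftrightarrow>
    (\<exists>f :: real \<Rightarrow> complex. \<forall>\<theta>\<in>{0..pi/2}. \<forall>\<phi>\<in>{0..<2*pi}.
       F (sph \<theta> \<phi>) = exp (\<i> * of_int m * of_real \<phi>) * f (cos \<theta>))"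

definition sector_eigenvalue :: "real \<Rightarrow> int \<Rightarrow> real \<Rightarrow> bool"
  where "sector_eigenvalue \<sigma> m \<mu> \<longleftrightarrow>
    (\<exists>F. robin_solution \<sigma> \<mu> F \<and> in_sector m F \<and> (\<exists>x\<in>hemisphere. F x \<noteq> 0))"

text \<open>
  The desymmetrized spectrum as a multiset: an eigenvalue occurs once for each \<open>m \<ge> 0\<close> in whose
  sector it has a nonzero eigenfunction.
\<close>

definition desym_spectrum :: "real \<Rightarrow> (nat \<times> real) set"
  where "desym_spectrum \<sigma> = {(m, \<mu>). sector_eigenvalue \<sigma> (int m) \<mu>}"

definition ordered_spectrum :: "real \<Rightarrow> (nat \<Rightarrow> real) \<Rightarrow> bool"
  where "ordered_spectrum \<sigma> l \<longleftrightarrow>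
    mono l \<and> (\<exists>s :: nat \<Rightarrow> nat. bij_betw (\<lambda>n. (s n, l n)) UNIV (desym_spectrum \<sigma>))"

text \<open>
  A nondecreasing enumeration of a multiset of reals by the natural numbers is unique if it exists,
  hence the definite description; the case \<open>\<sigma> = 0\<close> gives the Neumann eigenvalues.
\<close>

definition robin_ev :: "real \<Rightarrow> nat \<Rightarrow> real"
  where "robin_ev \<sigma> = (THE l. ordered_spectrum \<sigma> l)"

end

theory Submission
  imports Defs "HOL-Real_Asymp.Real_Asymp"
begin

text \<open>
  In the sector of \<open>exp (\<i> m \<phi>)\<close> write an eigenfunction as \<open>(x + \<i> y) ^ m u(z)\<close> with \<open>z = cos \<theta>\<close>. The
  factor \<open>u\<close> then solves
  \<open>(1 - z\<^sup>2) u'' - 2 (m + 1) z u' + (\<mu> - m (m + 1)) u = 0\<close>, the Robin condition becomes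
  \<open>u'(0) = \<sigma> u(0)\<close>, and smoothness at the pole singles out, up to scaling, the solution which is analytic at
  \<open>z = 1\<close>. That solution is a hypergeometric series in \<open>(1 - z) / 2\<close>, which converges as far as the equator
  and beyond. So the eigenvalues of the sector are exactly the \<open>\<mu>\<close> for which one explicit function of
  \<open>\<mu>\<close> vanishes (\<open>sector_eigenvalueI\<close>, \<open>sector_eigenvalueD\<close>).

  The values \<open>u(0)\<close> and \<open>u'(0)\<close> are products of reciprocal Gamma functions (\<open>hyp_half_rGamma\<close>): the
  differential equation at \<open>z = 0\<close> relates \<open>u(0)\<close> for \<open>m\<close> and for \<open>m + 2\<close>, and the dependence on
  \<open>\<mu>\<close> disappears as \<open>m\<close> grows. With \<open>\<mu> = \<nu> (\<nu> + 1)\<close> and the reflection formula, the Robin condition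
  becomes the secular equation
  \<open>2 sin (\<pi> p) G(p) G(q) = \<sigma> cos (\<pi> p)\<close>, where \<open>p = (\<nu> - m) / 2\<close>, \<open>q = (\<nu> + m) / 2\<close> and
  \<open>G(x) = \<Gamma>(x + 1) / \<Gamma>(x + 1/2)\<close> increases like \<open>sqrt x\<close> (\<open>secular_equation\<close>). Monotonicity gives
  exactly one root \<open>p = k + \<epsilon>\<close> with \<open>0 \<le> \<epsilon> < 1/2\<close> for each \<open>k\<close> and no others (\<open>sector_roots\<close>). Hence
  the eigenvalue with \<open>l = m + 2 k\<close> moves from \<open>l (l + 1)\<close>, its position for \<open>\<sigma> = 0\<close>, to some place before
  \<open>(l + 1) (l + 2)\<close>. It never reaches the next cluster, so the \<open>n\<close>-th eigenvalues for \<open>\<sigma>\<close> and for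
  \<open>0\<close> belong to the same \<open>l\<close> (\<open>robin_ev_same_level\<close>), whatever the order inside the clusters.

  It remains to bound the displacement, which is about \<open>4 l \<epsilon>\<close>. Since \<open>G(p) \<ge> G(0)\<close> and
  \<open>G(q) \<ge> sqrt (l / 2)\<close>, the secular equation yields \<open>\<epsilon> = O(\<sigma> / sqrt l)\<close> for all roots, which is the upper
  bound. For \<open>m = l\<close>, where the eigenfunctions concentrate most at the equator, \<open>G(p)\<close> stays bounded and
  \<open>\<epsilon>\<close> is of this order, which is the lower bound.
\<close>

section \<open>The regular solution as a hypergeometric series\<close>

text \<open>
  The Taylor coefficients of the hypergeometric function with upper parameters \<open>m - \<nu>\<close>, \<open>m + \<nu> + 1\<close>
  and lower parameter \<open>m + 1\<close>, where \<open>\<mu> = \<nu> (\<nu> + 1)\<close>. Pairing the factors of the two upper parameters leaves polynomials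
  in \<open>\<mu>\<close>, so that every real \<open>\<mu>\<close> is covered, also those with complex \<open>\<nu>\<close>.
\<close>

definition hyp_coeff :: "nat \<Rightarrow> real \<Rightarrow> nat \<Rightarrow> real"
  where "hyp_coeff m \<mu> k =
    (\<Prod>j<k. ((real m + real j) * (real m + real j + 1) - \<mu>) / ((real m + 1 + real j) * (real j + 1)))"

definition hyp :: "nat \<Rightarrow> real \<Rightarrow> real \<Rightarrow> real"
  where "hyp m \<mu> t = (\<Sum>k. hyp_coeff m \<mu> k * t ^ k)"

definition hyp_slope :: "nat \<Rightarrow> real \<Rightarrow> real"
  where "hyp_slope m \<mu> = (real m * (real m + 1) - \<mu>) / (real m + 1)"

lemma hyp_coeff_0 [simp]: "hyp_coeff m \<mu> 0 = 1"
  by (simp add: hyp_coeff_def)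

lemma hyp_coeff_Suc:
  "hyp_coeff m \<mu> (Suc k) * ((real m + 1 + real k) * (real k + 1)) =
     hyp_coeff m \<mu> k * ((real m + real k) * (real m + real k + 1) - \<mu>)"
proof -
  have "(real m + 1 + real k) * (real k + 1) \<noteq> 0"
    by (auto simp: add_eq_0_iff)
  then show ?thesis
    by (simp add: hyp_coeff_def)
qed

text \<open>
  Differentiation raises all three parameters of a hypergeometric function by one. Here this means
  \<open>m + 1\<close> in place of \<open>m\<close> with the same \<open>\<mu>\<close>, so the derivatives of all orders stay in the family.
\<close>

lemma hyp_coeff_shift:
  "real (Suc k) * hyp_coeff m \<mu> (Suc k) = hyp_slope m \<mu> * hyp_coeff (Suc m) \<mu> k"
proof (induction k)
  case 0
  then show ?case by (simp add: hyp_coeff_def hyp_slope_def)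
next
  case (Suc k)
  let ?N = "(real m + 1 + real k) * (real m + 1 + real k + 1) - \<mu>"
  have 1: "hyp_coeff m \<mu> (Suc (Suc k)) * ((real m + 2 + real k) * (real k + 2)) =
      hyp_coeff m \<mu> (Suc k) * ?N"
    using hyp_coeff_Suc[of m \<mu> "Suc k"] by (simp add: algebra_simps)
  have 2: "hyp_coeff (Suc m) \<mu> (Suc k) * ((real m + 2 + real k) * (real k + 1)) =
      hyp_coeff (Suc m) \<mu> k * ?N"
    using hyp_coeff_Suc[of "Suc m" \<mu> k] by (simp add: algebra_simps)
  have nz: "real m + 2 + real k \<noteq> 0" "real k + 1 \<noteq> 0" by linarith+
  have "(real m + 2 + real k) * (real k + 1) * (real (Suc (Suc k)) * hyp_coeff m \<mu> (Suc (Suc k)))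
      = (real k + 1) * (hyp_coeff m \<mu> (Suc k) * ?N)"
    unfolding 1[symmetric] by simp
  also have "\<dots> = hyp_slope m \<mu> * (hyp_coeff (Suc m) \<mu> k * ?N)"
    using Suc.IH by (simp add: mult.assoc[symmetric] add.commute)
  also have "\<dots> = (real m + 2 + real k) * (real k + 1) * (hyp_slope m \<mu> * hyp_coeff (Suc m) \<mu> (Suc k))"
    unfolding 2[symmetric] by simp
  finally show ?case using nz by (metis mult_cancel_left mult_eq_0_iff)
qed

lemma hyp_summable_norm:
  assumes "\<bar>t\<bar> < 1"
  shows "summable (\<lambda>k. norm (hyp_coeff m \<mu> k * t ^ k))"
proof -
  define q where "q = (\<bar>t\<bar> + 1) / 2"
  have q: "\<bar>t\<bar> < q" "q < 1" using assms by (auto simp: q_def)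
  have "((\<lambda>k. \<bar>((real m + real k) * (real m + real k + 1) - \<mu>)\<bar> / ((real m + 1 + real k) * (real k + 1))) \<longlongrightarrow> 1) at_top"
    by real_asymp
  then have "((\<lambda>k. \<bar>((real m + real k) * (real m + real k + 1) - \<mu>)\<bar> / ((real m + 1 + real k) * (real k + 1)) * \<bar>t\<bar>) \<longlongrightarrow> 1 * \<bar>t\<bar>) at_top"
    by (intro tendsto_intros)
  then have "eventually (\<lambda>k. \<bar>((real m + real k) * (real m + real k + 1) - \<mu>)\<bar> / ((real m + 1 + real k) * (real k + 1)) * \<bar>t\<bar> < q) at_top"
    using q by (intro order_tendstoD(2)) auto
  then obtain N where N: "\<And>k. k \<ge> N \<Longrightarrow> \<bar>((real m + real k) * (real m + real k + 1) - \<mu>)\<bar> / ((real m + 1 + real k) * (real k + 1)) * \<bar>t\<bar> < q"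
    by (auto simp: eventually_at_top_linorder)
  show ?thesis
  proof (rule summable_ratio_test[OF q(2)])
    fix k assume "k \<ge> N"
    let ?r = "((real m + real k) * (real m + real k + 1) - \<mu>) / ((real m + 1 + real k) * (real k + 1))"
    have r: "\<bar>?r\<bar> * \<bar>t\<bar> \<le> q"
      using N[OF \<open>k \<ge> N\<close>] by (simp add: abs_mult)
    have "hyp_coeff m \<mu> (Suc k) = hyp_coeff m \<mu> k * ?r"
      by (simp add: hyp_coeff_def)
    then have "norm (norm (hyp_coeff m \<mu> (Suc k) * t ^ Suc k)) = (\<bar>?r\<bar> * \<bar>t\<bar>) * norm (norm (hyp_coeff m \<mu> k * t ^ k))"
      by (simp only: abs_mult real_norm_def abs_idempotent power_Suc power_abs ac_simps)
    also have "\<dots> \<le> q * norm (norm (hyp_coeff m \<mu> k * t ^ k))"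
      by (intro mult_right_mono r) simp
    finally show "norm (norm (hyp_coeff m \<mu> (Suc k) * t ^ Suc k)) \<le> q * norm (norm (hyp_coeff m \<mu> k * t ^ k))" .
  qed
qed

lemma hyp_summable: "\<bar>t\<bar> < 1 \<Longrightarrow> summable (\<lambda>k. hyp_coeff m \<mu> k * t ^ k)"
  by (rule summable_norm_cancel[OF hyp_summable_norm])

lemma hyp_at_0 [simp]: "hyp m \<mu> 0 = 1"
  by (simp add: hyp_def powser_zero)

lemma hyp_deriv:
  assumes "\<bar>t\<bar> < 1"
  shows "(hyp m \<mu> has_real_derivative hyp_slope m \<mu> * hyp (Suc m) \<mu> t) (at t)"
proof -
  have "((\<lambda>t. \<Sum>k. hyp_coeff m \<mu> k * t ^ k) has_real_derivative (\<Sum>k. diffs (hyp_coeff m \<mu>) k * t ^ k)) (at t)"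
    by (rule termdiffs_strong[where K = "(\<bar>t\<bar> + 1) / 2"]) (use assms in \<open>auto intro!: hyp_summable\<close>)
  moreover have "(\<Sum>k. diffs (hyp_coeff m \<mu>) k * t ^ k) = (\<Sum>k. hyp_slope m \<mu> * (hyp_coeff (Suc m) \<mu> k * t ^ k))"
    by (simp add: diffs_def hyp_coeff_shift[simplified] mult.assoc)
  moreover have "\<dots> = hyp_slope m \<mu> * hyp (Suc m) \<mu> t"
    unfolding hyp_def using hyp_summable[OF assms, of "Suc m" \<mu>] by (rule suminf_mult)
  ultimately show ?thesis by (simp add: hyp_def[abs_def])
qed

text \<open>
  The hypergeometric differential equation: \<open>hyp (Suc m)\<close> and \<open>hyp (Suc (Suc m))\<close> are, up to constants, the
  first two derivatives of \<open>hyp m\<close>. The constant \<open>hyp_slope m\<close> is divided out, which keeps the relation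
  meaningful when it vanishes. The proof compares coefficients.
\<close>

lemma hyp_contiguous:
  assumes t: "\<bar>t\<bar> < 1"
  shows "t * (1 - t) * (hyp_slope (Suc m) \<mu> * hyp (Suc (Suc m)) \<mu> t) +
      (real m + 1) * (1 - 2 * t) * hyp (Suc m) \<mu> t = (real m + 1) * hyp m \<mu> t"
proof -
  define d where "d = hyp_coeff (Suc m) \<mu>"
  define c where "c = hyp_coeff m \<mu>"
  define e where "e k = (real k + 2 * real m + 2) * d k" for k
  have "summable (\<lambda>k. diffs d k * t ^ k)"
    by (rule termdiff_converges[of t 1]) (use t in \<open>auto simp: d_def intro: hyp_summable\<close>)
  moreover have dd: "diffs d k * t ^ k = hyp_slope (Suc m) \<mu> * (hyp_coeff (Suc (Suc m)) \<mu> k * t ^ k)" for k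
    using hyp_coeff_shift[of k "Suc m" \<mu>] by (simp add: diffs_def d_def mult.assoc)
  ultimately have s1: "(\<lambda>k. diffs d k * t ^ k) sums (hyp_slope (Suc m) \<mu> * hyp (Suc (Suc m)) \<mu> t)"
    unfolding hyp_def using sums_mult[OF summable_sums[OF hyp_summable[OF t]]] by (simp only: dd)
  define Y where "Y = hyp_slope (Suc m) \<mu> * hyp (Suc (Suc m)) \<mu> t"
  define y where "y = hyp (Suc m) \<mu> t"
  have s2: "(\<lambda>k. d k * t ^ k) sums y"
    unfolding y_def hyp_def d_def using hyp_summable[OF t] by (rule summable_sums)
  have s3: "(\<lambda>k. c k * t ^ k) sums hyp m \<mu> t"
    unfolding hyp_def c_def using hyp_summable[OF t] by (rule summable_sums)
  have "(\<lambda>k. real (Suc k) * d (Suc k) * t ^ Suc k) sums (t * Y)"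
    using sums_mult[OF s1, of t] by (simp add: diffs_def Y_def mult_ac)
  then have s4: "(\<lambda>k. real k * d k * t ^ k) sums (t * Y)"
    by (subst (asm) sums_Suc_iff) simp
  have s5: "(\<lambda>k. (real k + (real m + 1)) * d k * t ^ k) sums (t * Y + (real m + 1) * y)"
    using sums_add[OF s4 sums_mult[OF s2, of "real m + 1"]] by (simp add: algebra_simps)
  have s6: "(\<lambda>k. (real k + 2 * (real m + 1)) * d k * t ^ k) sums (t * Y + 2 * (real m + 1) * y)"
    using sums_add[OF s4 sums_mult[OF s2, of "2 * (real m + 1)"]] by (simp add: algebra_simps)
  have "(\<lambda>k. (real k + 2 * (real m + 1)) * d k * t ^ Suc k) sums (t * (t * Y + 2 * (real m + 1) * y))"
    using sums_mult[OF s6, of t] by (simp add: mult_ac)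
  then have s7: "(\<lambda>k. (if k = 0 then 0 else (real (k - 1) + 2 * (real m + 1)) * d (k - 1) * t ^ k)) sums (t * (t * Y + 2 * (real m + 1) * y))"
    by (subst sums_Suc_iff[symmetric, where f="\<lambda>k. if k = 0 then 0 else _ k", simplified]) simp
  have rel: "(real k + (real m + 1)) * d k * t ^ k - (if k = 0 then 0 else (real (k - 1) + 2 * (real m + 1)) * d (k - 1) * t ^ k)
     = (real m + 1) * (c k * t ^ k)" for k
  proof (cases k)
    case 0
    then show ?thesis by (simp add: d_def c_def)
  next
    case (Suc j)
    have a: "(real j + 1) * c (Suc j) * (real m + 1) = (real m * (real m + 1) - \<mu>) * d j"
      using hyp_coeff_shift[of j m \<mu>] by (simp add: c_def d_def hyp_slope_def field_simps)
    have b: "d (Suc j) * ((real m + 2 + real j) * (real j + 1)) = d j * ((real m + 1 + real j) * (real m + 2 + real j) - \<mu>)"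
      using hyp_coeff_Suc[of "Suc m" \<mu> j] by (simp add: d_def algebra_simps)
    have "(real j + 1) * ((real m + 2 + real j) * d (Suc j) - (real j + 2 * (real m + 1)) * d j) = (real j + 1) * ((real m + 1) * c (Suc j))"
      using a b by (simp add: algebra_simps)
    moreover have "real j + 1 \<noteq> 0" by linarith
    ultimately have "(real m + 2 + real j) * d (Suc j) - (real j + 2 * (real m + 1)) * d j = (real m + 1) * c (Suc j)"
      by (metis mult_cancel_left)
    then have "((real m + 2 + real j) * d (Suc j) - (real j + 2 * (real m + 1)) * d j) * t ^ Suc j = (real m + 1) * (c (Suc j) * t ^ Suc j)"
      by simp
    then show ?thesis unfolding Suc by (simp add: algebra_simps)
  qed
  have "(\<lambda>k. (real m + 1) * (c k * t ^ k)) sums (t * Y + (real m + 1) * y - t * (t * Y + 2 * (real m + 1) * y))"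
    using sums_diff[OF s5 s7] by (simp only: rel)
  moreover have "(\<lambda>k. (real m + 1) * (c k * t ^ k)) sums ((real m + 1) * hyp m \<mu> t)"
    by (rule sums_mult[OF s3])
  ultimately have "t * Y + (real m + 1) * y - t * (t * Y + 2 * (real m + 1) * y) = (real m + 1) * hyp m \<mu> t"
    by (rule sums_unique2)
  then show ?thesis by (simp add: Y_def y_def algebra_simps)
qed

section \<open>Its value on the equator\<close>

text \<open>
  The point \<open>t = 1/2\<close> is the equator. There the first-order term of the differential equation drops out, and
  the equation becomes a recursion with step two in \<open>m\<close>.
\<close>

lemma hyp_half_step:
  "hyp m \<mu> (1/2) = ((real m + 1) * (real m + 2) - \<mu>) / (4 * ((real m + 1) * (real m + 2))) * hyp (m + 2) \<mu> (1/2)"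
proof -
  have nz: "real m + 1 \<noteq> 0" "real m + 2 \<noteq> 0" by linarith+
  have "1/4 * (hyp_slope (Suc m) \<mu> * hyp (Suc (Suc m)) \<mu> (1/2)) = (real m + 1) * hyp m \<mu> (1/2)"
    using hyp_contiguous[of "1/2" m \<mu>] by simp
  then have "hyp m \<mu> (1/2) = hyp_slope (Suc m) \<mu> / (4 * (real m + 1)) * hyp (m + 2) \<mu> (1/2)"
    using nz by (simp add: field_simps)
  also have "hyp_slope (Suc m) \<mu> / (4 * (real m + 1)) = ((real m + 1) * (real m + 2) - \<mu>) / (4 * ((real m + 1) * (real m + 2)))"
    using nz by (simp add: hyp_slope_def divide_simps) (simp add: algebra_simps)
  finally show ?thesis .
qed

lemma hyp_half_iterate:
  "hyp m \<mu> (1/2) = (\<Prod>j<J. ((real m + 2 * real j + 1) * (real m + 2 * real j + 2) - \<mu>)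
       / (4 * ((real m + 2 * real j + 1) * (real m + 2 * real j + 2)))) * hyp (m + 2 * J) \<mu> (1/2)"
proof (induction J)
  case 0
  then show ?case by simp
next
  case (Suc J)
  show ?case
    by (subst Suc.IH, subst hyp_half_step) (simp add: add_ac mult_ac)
qed

lemma hyp_coeff_zero_nonneg: "hyp_coeff m 0 k \<ge> 0"
  unfolding hyp_coeff_def by (intro prod_nonneg) auto

text \<open>
  For \<open>\<mu> = 0\<close> the recursion has the constant factor \<open>1/4\<close>, so only \<open>m = 0\<close> (a constant) and \<open>m = 1\<close> (a
  geometric series) have to be summed.
\<close>

lemma hyp_half_zero: "hyp m 0 (1/2) = 2 ^ m"
proof (induction m rule: nat_less_induct)
  case (1 m)
  show ?case
  proof (cases "m < 2")
    case False
    then obtain k where k: "m = k + 2" by (metis add.commute le_Suc_ex not_less)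
    have nz: "real k + 1 \<noteq> 0" "real k + 2 \<noteq> 0" by linarith+
    have "hyp k 0 (1/2) = 1/4 * hyp m 0 (1/2)"
      using hyp_half_step[of k 0] nz unfolding k by (simp add: divide_simps)
    moreover have "hyp k 0 (1/2) = 2 ^ k" using 1 k by simp
    ultimately show ?thesis using k by simp
  next
    case True
    consider "m = 0" | "m = 1" using True by linarith
    then show ?thesis
    proof cases
      case 1
      have "hyp_coeff 0 0 k = (if k = 0 then 1 else 0)" for k
        unfolding hyp_coeff_def by (auto intro!: prod_zero bexI[of _ 0])
      then have "hyp 0 0 (1/2) = (\<Sum>k. if k = 0 then 1 else (0::real))"
        unfolding hyp_def by (intro suminf_cong) auto
      also have "\<dots> = 1" using suminf_finite[of "{0::nat}" "\<lambda>k. if k = 0 then 1 else (0::real)"] by simp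
      finally show ?thesis using 1 by simp
    next
      case 2
      have "hyp_coeff 1 0 k = 1" for k
        unfolding hyp_coeff_def
      proof (intro prod.neutral ballI)
        fix j :: nat
        have "real 1 + 1 + real j \<noteq> 0" "real j + 1 \<noteq> 0" by linarith+
        then show "((real 1 + real j) * (real 1 + real j + 1) - 0) / ((real 1 + 1 + real j) * (real j + 1)) = 1"
          by (simp add: divide_simps add_ac mult_ac)
      qed
      then have "hyp 1 0 (1/2) = (\<Sum>k. (1/2::real) ^ k)"
        unfolding hyp_def by simp
      then show ?thesis using 2 suminf_geometric[of "1/2::real"] by simp
    qed
  qed
qed

text \<open>
  The quotient of the two coefficients is \<open>\<Prod>j<k. 1 - \<mu> / ((m + j) (m + j + 1))\<close>, and the sum of the
  perturbations telescopes to at most \<open>\<bar>\<mu>\<bar> / m\<close>. The bound is uniform in \<open>k\<close>, and the coefficients for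
  \<open>\<mu> = 0\<close> are nonnegative, so it carries over to the sum of the series.
\<close>

lemma hyp_coeff_perturb:
  assumes "m \<ge> 1"
  shows "\<bar>hyp_coeff m \<mu> k - hyp_coeff m 0 k\<bar> \<le> (exp (\<bar>\<mu>\<bar> / real m) - 1) * hyp_coeff m 0 k"
proof -
  define x where "x j = - \<mu> / ((real m + real j) * (real m + real j + 1))" for j :: nat
  have m: "real m > 0" using assms by simp
  have nz: "real m + real j \<noteq> 0" "real m + real j + 1 \<noteq> 0" "real m + 1 + real j \<noteq> 0" "real j + 1 \<noteq> 0" for j
    using m by linarith+
  have "hyp_coeff m \<mu> k = hyp_coeff m 0 k * (\<Prod>j<k. 1 + x j)"
    unfolding hyp_coeff_def prod.distrib[symmetric] x_def
    by (intro prod.cong refl) (use nz in \<open>simp add: divide_simps\<close>)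
  then have "\<bar>hyp_coeff m \<mu> k - hyp_coeff m 0 k\<bar> = \<bar>hyp_coeff m 0 k * ((\<Prod>j<k. 1 + x j) - 1)\<bar>"
    by (simp add: algebra_simps)
  also have "\<dots> = \<bar>(\<Prod>j<k. 1 + x j) - 1\<bar> * hyp_coeff m 0 k"
    using hyp_coeff_zero_nonneg[of m k] by (simp add: abs_mult)
  also have "\<bar>(\<Prod>j<k. 1 + x j) - 1\<bar> \<le> (\<Prod>j<k. 1 + \<bar>x j\<bar>) - 1"
    using norm_prod_minus1_le_prod_minus1[of x "{..<k}"] by simp
  also have "(\<Prod>j<k. 1 + \<bar>x j\<bar>) \<le> exp (\<Sum>j<k. \<bar>x j\<bar>)"
    by (rule prod_le_exp_sum) simp
  also have "(\<Sum>j<k. \<bar>x j\<bar>) = \<bar>\<mu>\<bar> * (1 / real m - 1 / (real m + real k))"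
  proof (induction k)
    case 0
    then show ?case by simp
  next
    case (Suc k)
    have "\<bar>x k\<bar> = \<bar>\<mu>\<bar> * (1 / (real m + real k) - 1 / (real m + real (Suc k)))"
      unfolding x_def abs_divide abs_mult using m nz[of k] by (simp add: divide_simps)
    then show ?case using Suc by (simp add: algebra_simps)
  qed
  also have "\<dots> \<le> \<bar>\<mu>\<bar> * (1 / real m)"
    by (intro mult_left_mono) auto
  finally show ?thesis
    by (simp add: hyp_coeff_zero_nonneg mult_right_mono)
qed

lemma hyp_half_perturb:
  assumes "m \<ge> 1"
  shows "\<bar>hyp m \<mu> (1/2) / 2 ^ m - 1\<bar> \<le> exp (\<bar>\<mu>\<bar> / real m) - 1"
proof -
  let ?e = "exp (\<bar>\<mu>\<bar> / real m) - 1"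
  have s: "summable (\<lambda>k. hyp_coeff m \<nu> k * (1/2) ^ k)" for \<nu> by (rule hyp_summable) simp
  have bd: "norm (hyp_coeff m \<mu> k * (1/2) ^ k - hyp_coeff m 0 k * (1/2) ^ k) \<le> ?e * (hyp_coeff m 0 k * (1/2) ^ k)" for k
  proof -
    have "norm (hyp_coeff m \<mu> k * (1/2) ^ k - hyp_coeff m 0 k * (1/2) ^ k) = \<bar>hyp_coeff m \<mu> k - hyp_coeff m 0 k\<bar> * (1/2) ^ k"
      by (simp add: left_diff_distrib[symmetric] abs_mult del: power_divide)
    also have "\<dots> \<le> (?e * hyp_coeff m 0 k) * (1/2) ^ k"
      by (intro mult_right_mono hyp_coeff_perturb assms) simp
    finally show ?thesis by (simp add: mult.assoc)
  qed
  have "hyp m \<mu> (1/2) - hyp m 0 (1/2) = (\<Sum>k. hyp_coeff m \<mu> k * (1/2) ^ k - hyp_coeff m 0 k * (1/2) ^ k)"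
    unfolding hyp_def by (rule suminf_diff[OF s s])
  then have "\<bar>hyp m \<mu> (1/2) - hyp m 0 (1/2)\<bar> \<le> (\<Sum>k. ?e * (hyp_coeff m 0 k * (1/2) ^ k))"
    using norm_suminf_le[OF bd summable_mult[OF s[of 0]]] by simp
  also have "\<dots> = ?e * 2 ^ m"
    using suminf_mult[OF s[of 0], of ?e] hyp_half_zero[of m] by (simp add: hyp_def)
  finally have "\<bar>hyp m \<mu> (1/2) - 2 ^ m\<bar> \<le> ?e * 2 ^ m"
    by (simp add: hyp_half_zero)
  moreover have "hyp m \<mu> (1/2) / 2 ^ m - 1 = (hyp m \<mu> (1/2) - 2 ^ m) / 2 ^ m"
    by (simp add: diff_divide_distrib)
  ultimately show ?thesis by (simp add: abs_divide divide_simps)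
qed

text \<open>
  This determines the constant that an infinite iteration of \<open>hyp_half_step\<close> leaves open.
\<close>

lemma hyp_half_asymp: "(\<lambda>J. hyp (m + 2 * J) \<mu> (1/2) / 2 ^ (m + 2 * J)) \<longlonglongrightarrow> 1"
proof -
  have "(\<lambda>J. exp (\<bar>\<mu>\<bar> / real (m + 2 * J)) - 1) \<longlonglongrightarrow> 0"
    by real_asymp
  then have "(\<lambda>J. hyp (m + 2 * J) \<mu> (1/2) / 2 ^ (m + 2 * J) - 1) \<longlonglongrightarrow> 0"
  proof (rule Lim_null_comparison[rotated])
    show "\<forall>\<^sub>F J in sequentially. norm (hyp (m + 2 * J) \<mu> (1/2) / 2 ^ (m + 2 * J) - 1) \<le> exp (\<bar>\<mu>\<bar> / real (m + 2 * J)) - 1"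
      using eventually_ge_at_top[of 1] by eventually_elim (metis One_nat_def add_leD2 hyp_half_perturb le_add2 le_trans mult_2 real_norm_def)
  qed
  then show ?thesis by (simp add: LIM_zero_iff)
qed

text \<open>
  An instance of Gauss's second summation theorem. Iterating \<open>hyp_half_step\<close> gives a quotient of four
  Pochhammer symbols, each of which tends to a reciprocal Gamma value by Gauss's limit formula. The powers of \<open>J\<close> in
  that formula cancel because the two arguments above and the two arguments below the bar have the same sum.
\<close>

theorem hyp_half_rGamma:
  "hyp m (\<nu> * (\<nu> + 1)) (1/2) = 2 ^ m * (rGamma ((real m + 1 - \<nu>) / 2) * rGamma ((real m + 2 + \<nu>) / 2))
     / (rGamma ((real m + 1) / 2) * rGamma ((real m + 2) / 2))"
proof -
  let ?\<mu> = "\<nu> * (\<nu> + 1)"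
  let ?a = "(real m + 1 - \<nu>) / 2" and ?b = "(real m + 2 + \<nu>) / 2"
  let ?c = "(real m + 1) / 2" and ?d = "(real m + 2) / 2"
  define P where "P J = (\<Prod>j<J. ((real m + 2 * real j + 1) * (real m + 2 * real j + 2) - ?\<mu>)
       / (((real m + 2 * real j + 1) * (real m + 2 * real j + 2))))" for J
  define X where "X J = hyp (m + 2 * J) ?\<mu> (1/2) / 2 ^ (m + 2 * J)" for J
  have PX: "hyp m ?\<mu> (1/2) = 2 ^ m * (P J * X J)" for J
  proof -
    have "(\<Prod>j<J. ((real m + 2 * real j + 1) * (real m + 2 * real j + 2) - ?\<mu>)
       / (4 * ((real m + 2 * real j + 1) * (real m + 2 * real j + 2)))) = P J / 4 ^ J"
      unfolding P_def by (simp add: prod_dividef prod.distrib)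
    then show ?thesis
      using hyp_half_iterate[of m ?\<mu> J] by (simp add: X_def power_add power_mult)
  qed
  have pos: "rGamma ?c > 0" "rGamma ?d > 0"
    by (auto simp: rGamma_inverse_Gamma intro!: Gamma_real_pos)
  have eq: "\<forall>\<^sub>F J in sequentially. P (J + 1) = (rGamma_series ?a J * rGamma_series ?b J) / (rGamma_series ?c J * rGamma_series ?d J)"
    using eventually_gt_at_top[of 0]
  proof eventually_elim
    case (elim J)
    have prod: "P (J + 1) = (pochhammer ?a (J + 1) * pochhammer ?b (J + 1)) / (pochhammer ?c (J + 1) * pochhammer ?d (J + 1))"
      unfolding P_def pochhammer_prod atLeast0LessThan prod.distrib[symmetric] prod_dividef[symmetric]
    proof (intro prod.cong refl)
      fix j
      \<comment> \<open>halving the arguments of the Pochhammer symbols divides each product of two factors by \<open>4\<close>\<close>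
    have q: "x / y = (x / 4) / (y / 4)" for x y :: real
        by simp
      have e: "(?a + real j) * (?b + real j) = ((real m + 2 * real j + 1) * (real m + 2 * real j + 2) - ?\<mu>) / 4"
        "(?c + real j) * (?d + real j) = ((real m + 2 * real j + 1) * (real m + 2 * real j + 2)) / 4"
        by (simp_all add: field_simps)
      show "((real m + 2 * real j + 1) * (real m + 2 * real j + 2) - ?\<mu>)
         / (((real m + 2 * real j + 1) * (real m + 2 * real j + 2))) = (?a + of_nat j) * (?b + of_nat j) / ((?c + of_nat j) * (?d + of_nat j))"
        unfolding e using q by blast
    qed
    have e: "exp (?a * L) * exp (?b * L) = exp (?c * L) * exp (?d * L)" for L :: real
      by (simp add: exp_add[symmetric] field_simps)
    show ?case
    proof -
      define K where "K z = fact J * exp (z * of_real (ln (of_nat J)))" for z :: real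
      have k: "K ?a * K ?b = K ?c * K ?d" "K ?c \<noteq> 0" "K ?d \<noteq> 0"
        using e[of "ln (real J)"] by (simp_all add: K_def)
      have cancel: "x * y / (z * w) = (x / a * (y / b)) / (z / c * (w / d))"
        if "a * b = c * d" "c \<noteq> 0" "d \<noteq> 0" for x y z w a b c d :: real
      proof -
        have "a \<noteq> 0" "b \<noteq> 0" using that by auto
        then have "(x / a * (y / b)) / (z / c * (w / d)) = (x * y / (z * w)) * ((c * d) / (a * b))"
          by simp
        then show ?thesis using that by simp
      qed
      show ?thesis
        unfolding prod rGamma_series_def K_def[symmetric] by (rule cancel[OF k])
    qed
  qed
  have "(\<lambda>J. (rGamma_series ?a J * rGamma_series ?b J) / (rGamma_series ?c J * rGamma_series ?d J)) \<longlonglongrightarrow> (rGamma ?a * rGamma ?b) / (rGamma ?c * rGamma ?d)"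
    using pos by (intro tendsto_intros) auto
  then have "(\<lambda>J. P (J + 1)) \<longlonglongrightarrow> (rGamma ?a * rGamma ?b) / (rGamma ?c * rGamma ?d)"
    using tendsto_cong[OF eq] by simp
  moreover have "(\<lambda>J. X (J + 1)) \<longlonglongrightarrow> 1"
    unfolding X_def using hyp_half_asymp[of m ?\<mu>] by (rule LIMSEQ_ignore_initial_segment)
  ultimately have "(\<lambda>J. 2 ^ m * (P (J + 1) * X (J + 1))) \<longlonglongrightarrow> 2 ^ m * ((rGamma ?a * rGamma ?b) / (rGamma ?c * rGamma ?d) * 1)"
    by (intro tendsto_intros)
  then have "(\<lambda>J. hyp m ?\<mu> (1/2)) \<longlonglongrightarrow> 2 ^ m * ((rGamma ?a * rGamma ?b) / (rGamma ?c * rGamma ?d) * 1)"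
    by (simp only: PX[symmetric])
  then have "hyp m ?\<mu> (1/2) = 2 ^ m * ((rGamma ?a * rGamma ?b) / (rGamma ?c * rGamma ?d) * 1)"
    using LIMSEQ_const_iff by blast
  then show ?thesis by simp
qed

section \<open>A quotient of Gamma functions\<close>

definition gamma_quot :: "real \<Rightarrow> real"
  where "gamma_quot x = Gamma (x + 1) / Gamma (x + 1/2)"

lemma gamma_quot_pos: "x \<ge> 0 \<Longrightarrow> gamma_quot x > 0"
  by (simp add: gamma_quot_def)

text \<open>
  The logarithmic derivative is a difference of two values of the increasing function \<open>Digamma\<close>.
\<close>

lemma gamma_quot_mono:
  assumes "0 \<le> x" "x \<le> y"
  shows "gamma_quot x \<le> gamma_quot y"
proof -
  have "ln_Gamma (x + 1) - ln_Gamma (x + 1/2) \<le> ln_Gamma (y + 1) - ln_Gamma (y + 1/2)"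
  proof (rule DERIV_nonneg_imp_nondecreasing[OF assms(2)])
    fix s assume s: "x \<le> s" "s \<le> y"
    then have "s \<ge> 0" using assms by simp
    then have "((\<lambda>x. ln_Gamma (x + 1) - ln_Gamma (x + 1/2)) has_real_derivative (Digamma (s + 1) - Digamma (s + 1/2))) (at s)"
      by (auto intro!: derivative_eq_intros)
    moreover have "Digamma (s + 1/2) \<le> Digamma (s + 1)"
      using \<open>s \<ge> 0\<close> by (intro Digamma_real_mono) auto
    ultimately show "\<exists>d. ((\<lambda>x. ln_Gamma (x + 1) - ln_Gamma (x + 1/2)) has_real_derivative d) (at s) \<and> 0 \<le> d"
      by force
  qed
  moreover have "gamma_quot z = exp (ln_Gamma (z + 1) - ln_Gamma (z + 1/2))" if "z \<ge> 0" for z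
    using that by (simp add: gamma_quot_def exp_diff Gamma_real_pos_exp)
  ultimately show ?thesis using assms by simp
qed

lemma continuous_on_gamma_quot: "continuous_on {0..} gamma_quot"
proof -
  have "continuous_on {0<..} (Gamma :: real \<Rightarrow> real)"
    by (intro continuous_on_Gamma) (auto elim!: nonpos_Ints_cases)
  then have G: "continuous_on {0..} (\<lambda>x. Gamma (x + a))" if "a > 0" for a :: real
    by (rule continuous_on_compose2) (use that in \<open>auto intro!: continuous_intros\<close>)
  have "Gamma (x + 1/2) \<noteq> 0" if "x \<ge> 0" for x :: real
  proof -
    have "Gamma (x + 1/2) > 0" using that by (intro Gamma_real_pos) simp
    then show ?thesis by linarith
  qed
  then show ?thesis
    unfolding gamma_quot_def[abs_def] by (intro continuous_on_divide G) auto
qed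

text \<open>
  Together with monotonicity this encloses \<open>gamma_quot x\<close> between two square roots, which is all that is
  needed of its asymptotics.
\<close>

lemma gamma_quot_step:
  assumes "x \<ge> 0"
  shows "gamma_quot x * gamma_quot (x + 1/2) = x + 1/2"
proof -
  have "Gamma (x + 1/2 + 1) = (x + 1/2) * Gamma (x + 1/2)"
    using assms by (intro Gamma_plus1) (auto elim!: nonpos_Ints_cases)
  moreover have "Gamma (x + 1) > 0" "Gamma (x + 1/2) > 0" using assms by auto
  ultimately show ?thesis by (simp add: gamma_quot_def add.assoc)
qed

lemma gamma_quot_upper:
  assumes "x \<ge> 0"
  shows "gamma_quot x \<le> sqrt (x + 1/2)"
proof (rule real_le_rsqrt)
  have "gamma_quot x * gamma_quot x \<le> gamma_quot x * gamma_quot (x + 1/2)"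
    using assms gamma_quot_pos[of x] by (intro mult_left_mono gamma_quot_mono) auto
  then show "(gamma_quot x)\<^sup>2 \<le> x + 1/2"
    using gamma_quot_step[OF assms] by (simp add: power2_eq_square)
qed

lemma gamma_quot_lower:
  assumes "x \<ge> 1/2"
  shows "gamma_quot x \<ge> sqrt x"
proof (rule real_le_lsqrt)
  have "gamma_quot (x - 1/2) * gamma_quot x \<le> gamma_quot x * gamma_quot x"
    using assms gamma_quot_pos[of x] by (intro mult_right_mono gamma_quot_mono) auto
  then show "x \<le> (gamma_quot x)\<^sup>2"
    using gamma_quot_step[of "x - 1/2"] assms by (simp add: power2_eq_square)
qed (use assms gamma_quot_pos[of x] in auto)

lemma gamma_quot_0: "gamma_quot 0 = 1 / sqrt pi"
  by (simp add: gamma_quot_def Gamma_one_half_real)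

lemma rGamma_reflection_real: "rGamma x * rGamma (1 - x) = sin (pi * x) / (pi :: real)"
proof -
  have "complex_of_real (rGamma x * rGamma (1 - x)) = rGamma (of_real x) * rGamma (1 - of_real x)"
    using rGamma_complex_of_real[of x] rGamma_complex_of_real[of "1 - x"] by simp
  also have "\<dots> = sin (of_real pi * of_real x) / of_real pi"
    by (rule rGamma_reflection_complex)
  also have "\<dots> = of_real (sin (pi * x) / pi)"
    using sin_of_real[of "pi * x"] by simp
  finally have "complex_of_real (rGamma x * rGamma (1 - x)) = of_real (sin (pi * x) / pi)" .
  then show ?thesis by (simp only: of_real_eq_iff)
qed

section \<open>The secular equation\<close>

text \<open>
  The derivative at \<open>z = 0\<close> of the function \<open>hyp m \<mu> ((1 - z) / 2)\<close>, hence the factor \<open>-1/2\<close>.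
\<close>

definition equator_slope :: "nat \<Rightarrow> real \<Rightarrow> real"
  where "equator_slope m \<mu> = - hyp_slope m \<mu> * hyp (Suc m) \<mu> (1/2) / 2"

text \<open>
  By \<open>hyp_half_rGamma\<close>, both sides are products of reciprocal Gamma functions. Those with the arguments
  \<open>- p\<close> and \<open>1/2 - p\<close> may vanish; the reflection formula exhibits their zeros as the zeros of a sine and a
  cosine, and the remaining factors are positive and combine to the two Gamma quotients.
\<close>

lemma secular_equation:
  assumes "real m \<le> \<nu>"
  defines "p \<equiv> (\<nu> - real m) / 2" and "q \<equiv> (\<nu> + real m) / 2"
  shows "equator_slope m (\<nu> * (\<nu> + 1)) = \<sigma> * hyp m (\<nu> * (\<nu> + 1)) (1/2) \<longleftrightarrow>
     2 * sin (pi * p) * gamma_quot p * gamma_quot q = \<sigma> * cos (pi * p)"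
proof -
  have pq: "p \<ge> 0" "q \<ge> 0" "real m = q - p" "\<nu> = p + q"
    using assms by (auto simp: field_simps)
  define c where "c = rGamma ((real m + 1) / 2)"
  define d where "d = rGamma ((real m + 2) / 2)"
  define e where "e = rGamma ((real m + 3) / 2)"
  have pos: "c > 0" "d > 0" "e > 0"
    by (auto simp: c_def d_def e_def rGamma_inverse_Gamma intro!: Gamma_real_pos)
  have ce: "c = (real m + 1) / 2 * e"
    using rGamma_plus1[of "(real m + 1) / 2"] by (simp add: c_def e_def field_simps)
  have s0: "hyp m (\<nu> * (\<nu> + 1)) (1/2) = 2 ^ m * (rGamma (1/2 - p) * rGamma (q + 1)) / (c * d)"
    unfolding hyp_half_rGamma c_def d_def
    by (rule arg_cong2[of _ _ _ _ "(/)"], rule arg_cong2[of _ _ _ _ "(*)"], rule refl,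
        rule arg_cong2[of _ _ _ _ "(*)"]) (simp_all add: p_def q_def field_simps)
  have "hyp (Suc m) (\<nu> * (\<nu> + 1)) (1/2) = 2 ^ Suc m * (rGamma (- p + 1) * rGamma (q + 1/2 + 1)) / (d * e)"
    unfolding hyp_half_rGamma e_def d_def
    by (rule arg_cong2[of _ _ _ _ "(/)"], rule arg_cong2[of _ _ _ _ "(*)"], rule refl,
        rule arg_cong2[of _ _ _ _ "(*)"]) (simp_all add: p_def q_def field_simps)
  moreover have "hyp_slope m (\<nu> * (\<nu> + 1)) = 4 * ((- p) * (q + 1/2)) / (real m + 1)"
    unfolding hyp_slope_def by (rule arg_cong2[of _ _ _ _ "(/)"]) (simp_all add: p_def q_def field_simps)
  moreover have "- (4 * ((- p) * Q) / M) * (2 ^ Suc m * (X * Y) / (d * e)) / 2 = - 4 * 2 ^ m * ((- p) * X) * (Q * Y) / (d * (M * e))"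
    for Q M X Y :: real by (simp add: mult_ac)
  ultimately have "equator_slope m (\<nu> * (\<nu> + 1)) =
      - 4 * 2 ^ m * ((- p) * rGamma (- p + 1)) * ((q + 1/2) * rGamma (q + 1/2 + 1)) / (d * ((real m + 1) * e))"
    unfolding equator_slope_def by (simp only:)
  also have "\<dots> = - 4 * 2 ^ m * rGamma (- p) * rGamma (q + 1/2) / (d * (2 * c))"
    unfolding rGamma_plus1 ce by simp
  also have "\<dots> = 2 ^ m * (- 2 * rGamma (- p) * rGamma (q + 1/2)) / (c * d)"
    by simp
  finally have s1: "equator_slope m (\<nu> * (\<nu> + 1)) = 2 ^ m * (- 2 * rGamma (- p) * rGamma (q + 1/2)) / (c * d)" .
  define a where "a = rGamma (p + 1)"
  define b where "b = rGamma (p + 1/2)"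
  define g where "g = rGamma (q + 1)"
  define h where "h = rGamma (q + 1/2)"
  have pos': "a > 0" "b > 0" "g > 0" "h > 0"
    using pq by (auto simp: a_def b_def g_def h_def rGamma_inverse_Gamma intro!: Gamma_real_pos)
  have r1: "rGamma (- p) * a = - sin (pi * p) / pi"
    using rGamma_reflection_real[of "- p"] by (simp add: a_def add.commute)
  have r2: "rGamma (1/2 - p) * b = cos (pi * p) / pi"
    using rGamma_reflection_real[of "1/2 - p"]
    by (simp add: b_def add.commute right_diff_distrib sin_diff)
  have gq: "gamma_quot p = b / a" "gamma_quot q = h / g"
    by (simp_all add: gamma_quot_def a_def b_def g_def h_def rGamma_inverse_Gamma field_simps)
  have "equator_slope m (\<nu> * (\<nu> + 1)) = \<sigma> * hyp m (\<nu> * (\<nu> + 1)) (1/2) \<longleftrightarrow>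
      - 2 * rGamma (- p) * h = \<sigma> * (rGamma (1/2 - p) * g)"
  proof -
    have "2 ^ m * u / (c * d) = \<sigma> * (2 ^ m * v / (c * d)) \<longleftrightarrow> u = \<sigma> * v" for u v :: real
    proof -
      have "2 ^ m * u / (c * d) = \<sigma> * (2 ^ m * v / (c * d)) \<longleftrightarrow> 2 ^ m / (c * d) * u = 2 ^ m / (c * d) * (\<sigma> * v)"
        by (simp add: mult_ac)
      moreover have "2 ^ m / (c * d) \<noteq> 0" using pos by simp
      ultimately show ?thesis by (simp only: mult_cancel_left simp_thms)
    qed
    then show ?thesis unfolding s0 s1 h_def[symmetric] g_def[symmetric] by blast
  qed
  also have "\<dots> \<longleftrightarrow> (pi * a * b) * (- 2 * rGamma (- p) * h) = (pi * a * b) * (\<sigma> * (rGamma (1/2 - p) * g))"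
  proof -
    have "pi * a * b \<noteq> 0" using pos' by simp
    then show ?thesis by (simp only: mult_cancel_left simp_thms)
  qed
  also have "(pi * a * b) * (- 2 * rGamma (- p) * h) = 2 * sin (pi * p) * b * h"
  proof -
    have "(pi * a * b) * (- 2 * rGamma (- p) * h) = - 2 * (pi * (rGamma (- p) * a)) * b * h"
      by simp
    then show ?thesis unfolding r1 by simp
  qed
  also have "(pi * a * b) * (\<sigma> * (rGamma (1/2 - p) * g)) = \<sigma> * cos (pi * p) * a * g"
  proof -
    have "(pi * a * b) * (\<sigma> * (rGamma (1/2 - p) * g)) = \<sigma> * (pi * (rGamma (1/2 - p) * b)) * a * g"
      by simp
    then show ?thesis unfolding r2 by simp
  qed
  also have "(2 * sin (pi * p) * b * h = \<sigma> * cos (pi * p) * a * g) \<longleftrightarrow>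
     2 * sin (pi * p) * gamma_quot p * gamma_quot q = \<sigma> * cos (pi * p)"
  proof -
    have "2 * sin (pi * p) * (b / a) * (h / g) = (2 * sin (pi * p) * b * h) / (a * g)"
      by simp
    then show ?thesis unfolding gq using pos' by (simp add: nonzero_divide_eq_eq mult.assoc)
  qed
  finally show ?thesis .
qed

lemma hyp_half_pos:
  assumes "\<mu> < real m * (real m + 1)"
  shows "hyp m \<mu> (1/2) > 0"
proof -
  have "hyp_coeff m \<mu> k \<ge> 0" for k
    unfolding hyp_coeff_def
  proof (intro prod_nonneg divide_nonneg_nonneg ballI)
    fix j
    have "real m * (real m + 1) \<le> (real m + real j) * (real m + real j + 1)"
      by (intro mult_mono) auto
    then show "0 \<le> (real m + real j) * (real m + real j + 1) - \<mu>" using assms by linarith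
  qed auto
  then have "(\<Sum>k\<in>{0}. hyp_coeff m \<mu> k * (1/2) ^ k) \<le> hyp m \<mu> (1/2)"
    unfolding hyp_def by (intro sum_le_suminf hyp_summable) auto
  then show ?thesis by simp
qed

text \<open>
  For \<open>\<mu> < m (m + 1)\<close> the series has positive coefficients, so the solution is positive and still growing
  when it arrives at the equator from the pole. The Robin condition with \<open>\<sigma> \<ge> 0\<close> forbids this.
\<close>

lemma no_root_below:
  assumes "\<mu> < real m * (real m + 1)" "\<sigma> \<ge> 0"
  shows "equator_slope m \<mu> \<noteq> \<sigma> * hyp m \<mu> (1/2)"
proof -
  have "real m * (real m + 1) \<le> real (Suc m) * (real (Suc m) + 1)"
    by (intro mult_mono) auto
  then have "hyp (Suc m) \<mu> (1/2) > 0" using assms by (intro hyp_half_pos) linarith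
  moreover have "hyp_slope m \<mu> > 0" using assms by (simp add: hyp_slope_def)
  ultimately have "equator_slope m \<mu> < 0" by (simp add: equator_slope_def)
  moreover have "\<sigma> * hyp m \<mu> (1/2) \<ge> 0"
    using assms hyp_half_pos[of \<mu> m] by simp
  ultimately show ?thesis by linarith
qed

section \<open>The roots and their displacement\<close>

text \<open>
  The secular equation at \<open>p = k + \<epsilon>\<close>, after cancelling the common sign \<open>(-1) ^ k\<close>. The endpoints
  \<open>\<epsilon> = 0\<close> and \<open>\<epsilon> = 1/2\<close> correspond to the Neumann and the Dirichlet problem.
\<close>

definition shift_eq :: "real \<Rightarrow> nat \<Rightarrow> nat \<Rightarrow> real \<Rightarrow> bool"
  where "shift_eq \<sigma> m k \<epsilon> \<longleftrightarrow> 0 \<le> \<epsilon> \<and> \<epsilon> < 1/2 \<and>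
     2 * sin (pi * \<epsilon>) * gamma_quot (real k + \<epsilon>) * gamma_quot (real m + real k + \<epsilon>) = \<sigma> * cos (pi * \<epsilon>)"

text \<open>
  The left side of the secular equation strictly increases and the right side decreases on \<open>[0, 1/2)\<close>.
\<close>

lemma shift_eq_unique:
  assumes "\<sigma> \<ge> 0" "shift_eq \<sigma> m k \<epsilon>" "shift_eq \<sigma> m k \<epsilon>'"
  shows "\<epsilon> = \<epsilon>'"
proof -
  have False if "\<epsilon> < \<epsilon>'" and s: "shift_eq \<sigma> m k \<epsilon>" "shift_eq \<sigma> m k \<epsilon>'" for \<epsilon> \<epsilon>'
  proof -
    let ?G = "\<lambda>\<epsilon>. gamma_quot (real k + \<epsilon>) * gamma_quot (real m + real k + \<epsilon>)"
    have b: "0 \<le> \<epsilon>" "\<epsilon>' < 1/2" using s by (auto simp: shift_eq_def)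
    have l: "pi * \<epsilon> < pi * \<epsilon>'" "pi * \<epsilon>' < pi/2" "0 \<le> pi * \<epsilon>"
      using b that(1) by auto
    have "sin (pi * \<epsilon>) < sin (pi * \<epsilon>')"
      using l pi_gt_zero by (intro sin_monotone_2pi) linarith+
    moreover have "0 < ?G \<epsilon>" using b by (intro mult_pos_pos gamma_quot_pos) auto
    moreover have "?G \<epsilon> \<le> ?G \<epsilon>'"
      using b that(1) by (intro mult_mono gamma_quot_mono less_imp_le[OF gamma_quot_pos]) auto
    moreover have "0 \<le> sin (pi * \<epsilon>)" using l by (intro sin_ge_zero) auto
    ultimately have "sin (pi * \<epsilon>) * ?G \<epsilon> < sin (pi * \<epsilon>') * ?G \<epsilon>'"
      by (intro mult_less_le_imp_less) auto
    moreover have "\<sigma> * cos (pi * \<epsilon>') \<le> \<sigma> * cos (pi * \<epsilon>)"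
      using assms(1) l by (intro mult_left_mono cos_monotone_0_pi_le) auto
    moreover have "2 * (sin (pi * \<epsilon>) * ?G \<epsilon>) = \<sigma> * cos (pi * \<epsilon>)" "2 * (sin (pi * \<epsilon>') * ?G \<epsilon>') = \<sigma> * cos (pi * \<epsilon>')"
      using s by (auto simp: shift_eq_def mult_ac)
    ultimately show False by linarith
  qed
  then show ?thesis using assms by (metis linorder_neqE)
qed

text \<open>
  At \<open>\<epsilon> = 0\<close> the sine vanishes and at \<open>\<epsilon> = 1/2\<close> the cosine does, so the intermediate value theorem
  applies.
\<close>

lemma shift_eq_exists:
  assumes "\<sigma> \<ge> 0"
  shows "\<exists>\<epsilon>. shift_eq \<sigma> m k \<epsilon>"
proof -
  define f where "f \<epsilon> = 2 * sin (pi * \<epsilon>) * gamma_quot (real k + \<epsilon>) * gamma_quot (real m + real k + \<epsilon>) - \<sigma> * cos (pi * \<epsilon>)" for \<epsilon>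
  have "continuous_on {0..1/2} f"
    unfolding f_def[abs_def]
    by (intro continuous_intros continuous_on_compose2[OF continuous_on_gamma_quot]) auto
  moreover have "f 0 \<le> 0" using assms by (simp add: f_def)
  moreover have f1: "f (1/2) > 0" by (auto simp: f_def intro!: mult_pos_pos gamma_quot_pos)
  ultimately obtain \<epsilon> where e: "0 \<le> \<epsilon>" "\<epsilon> \<le> 1/2" "f \<epsilon> = 0"
    using IVT'[of f 0 0 "1/2"] by auto
  then have "\<epsilon> \<noteq> 1/2" using f1 by (metis less_irrefl)
  then show ?thesis using e by (intro exI[of _ \<epsilon>]) (auto simp: shift_eq_def f_def)
qed

definition robin_shift :: "real \<Rightarrow> nat \<Rightarrow> nat \<Rightarrow> real"
  where "robin_shift \<sigma> m k = (THE \<epsilon>. shift_eq \<sigma> m k \<epsilon>)"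

lemma robin_shift:
  assumes "\<sigma> \<ge> 0"
  shows "shift_eq \<sigma> m k \<epsilon> \<longleftrightarrow> \<epsilon> = robin_shift \<sigma> m k"
proof -
  have "\<exists>!\<epsilon>. shift_eq \<sigma> m k \<epsilon>"
    using shift_eq_exists[OF assms] shift_eq_unique[OF assms] by blast
  then show ?thesis unfolding robin_shift_def by (metis the1_equality)
qed

lemma robin_shift_zero: "robin_shift 0 m k = 0"
  using robin_shift[of 0 m k 0] by (simp add: shift_eq_def)

text \<open>
  The value of \<open>\<nu> (\<nu> + 1)\<close> for \<open>\<nu> = l + 2 \<epsilon>\<close>.
\<close>

definition root_value :: "nat \<Rightarrow> real \<Rightarrow> real"
  where "root_value l \<epsilon> = (real l + 2 * \<epsilon>) * (real l + 2 * \<epsilon> + 1)"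

text \<open>
  Every \<open>\<nu> \<ge> m\<close> has the form \<open>m + 2 k + 2 \<epsilon>\<close> with \<open>0 \<le> \<epsilon> < 1\<close>. The range
  \<open>1/2 \<le> \<epsilon> < 1\<close> contains no root, since there the sine is positive and the cosine is not.
\<close>

lemma sector_roots:
  assumes "\<sigma> \<ge> 0"
  shows "equator_slope m \<mu> = \<sigma> * hyp m \<mu> (1/2) \<longleftrightarrow> (\<exists>k. \<mu> = root_value (m + 2 * k) (robin_shift \<sigma> m k))"
proof -
  have main: "equator_slope m (\<nu> * (\<nu> + 1)) = \<sigma> * hyp m (\<nu> * (\<nu> + 1)) (1/2) \<longleftrightarrow>
      2 * sin (pi * \<epsilon>) * gamma_quot (real k + \<epsilon>) * gamma_quot (real m + real k + \<epsilon>) = \<sigma> * cos (pi * \<epsilon>)"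
    if nu: "\<nu> = real (m + 2 * k) + 2 * \<epsilon>" and e: "0 \<le> \<epsilon>" for \<nu> \<epsilon> k
  proof -
    have p: "(\<nu> - real m) / 2 = real k + \<epsilon>" "(\<nu> + real m) / 2 = real m + real k + \<epsilon>"
      using nu by (auto simp: field_simps)
    have s: "sin (pi * (real k + \<epsilon>)) = (- 1) ^ k * sin (pi * \<epsilon>)"
      "cos (pi * (real k + \<epsilon>)) = (- 1) ^ k * cos (pi * \<epsilon>)"
      by (simp_all add: distrib_left sin_add cos_add mult.commute[of pi "real k"])
    have "real m \<le> \<nu>" using nu e by simp
    from secular_equation[OF this, of \<sigma>] show ?thesis
      unfolding p s by (cases "even k") auto
  qed
  show ?thesis
  proof
    assume *: "equator_slope m \<mu> = \<sigma> * hyp m \<mu> (1/2)"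
    then have mu: "\<mu> \<ge> real m * (real m + 1)"
      using no_root_below[OF _ assms] by (meson not_less)
    \<comment> \<open>the nonnegative solution of \<open>\<nu> (\<nu> + 1) = \<mu>\<close>\<close>
    define \<nu> where "\<nu> = (sqrt (1 + 4 * \<mu>) - 1) / 2"
    have mu0: "\<mu> \<ge> 0" by (rule order_trans[OF _ mu]) simp
    have numu: "\<nu> * (\<nu> + 1) = \<mu>"
    proof -
      have "sqrt (1 + 4 * \<mu>) * sqrt (1 + 4 * \<mu>) = 1 + 4 * \<mu>" using mu0 by simp
      moreover have "(r - 1) / 2 * ((r - 1) / 2 + 1) = (r * r - 1) / 4" for r :: real
        by (simp add: field_simps)
      ultimately have "\<nu> * (\<nu> + 1) = ((1 + 4 * \<mu>) - 1) / 4" unfolding \<nu>_def by (simp only:)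
      then show ?thesis by simp
    qed
    have "(2 * real m + 1)\<^sup>2 \<le> 1 + 4 * \<mu>"
      using mu by (simp add: power2_eq_square algebra_simps)
    then have "2 * real m + 1 \<le> sqrt (1 + 4 * \<mu>)" by (rule real_le_rsqrt)
    then have nu: "real m \<le> \<nu>" by (simp add: \<nu>_def)
    define k where "k = nat \<lfloor>(\<nu> - real m) / 2\<rfloor>"
    define \<epsilon> where "\<epsilon> = (\<nu> - real m) / 2 - real k"
    have rk: "real k = of_int \<lfloor>(\<nu> - real m) / 2\<rfloor>"
      using nu by (simp add: k_def)
    have e: "0 \<le> \<epsilon>" "\<epsilon> < 1"
      unfolding \<epsilon>_def rk by linarith+
    have nue: "\<nu> = real (m + 2 * k) + 2 * \<epsilon>" by (simp add: \<epsilon>_def field_simps)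
    have eq: "2 * sin (pi * \<epsilon>) * gamma_quot (real k + \<epsilon>) * gamma_quot (real m + real k + \<epsilon>) = \<sigma> * cos (pi * \<epsilon>)"
      using main[OF nue e(1)] * numu by simp
    have "\<epsilon> < 1/2"
    proof (rule ccontr)
      assume "\<not> \<epsilon> < 1/2"
      then have ge: "pi/2 \<le> pi * \<epsilon>" by simp
      have lt: "pi * \<epsilon> < pi" using e by simp
      have "sin (pi * \<epsilon>) > 0" using ge lt pi_gt_zero by (intro sin_gt_zero) linarith+
      then have "2 * sin (pi * \<epsilon>) * gamma_quot (real k + \<epsilon>) * gamma_quot (real m + real k + \<epsilon>) > 0"
        using e by (intro mult_pos_pos gamma_quot_pos) auto
      moreover have "cos (pi * \<epsilon>) \<le> cos (pi / 2)"
        using ge lt by (intro cos_monotone_0_pi_le) auto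
      then have "\<sigma> * cos (pi * \<epsilon>) \<le> 0" using assms by (simp add: mult_nonneg_nonpos)
      ultimately show False using eq by linarith
    qed
    then have "\<epsilon> = robin_shift \<sigma> m k"
      using robin_shift[OF assms, of m k \<epsilon>] e eq by (simp add: shift_eq_def)
    then show "\<exists>k. \<mu> = root_value (m + 2 * k) (robin_shift \<sigma> m k)"
      using nue numu unfolding root_value_def by metis
  next
    assume "\<exists>k. \<mu> = root_value (m + 2 * k) (robin_shift \<sigma> m k)"
    then obtain k where k: "\<mu> = root_value (m + 2 * k) (robin_shift \<sigma> m k)" by blast
    have "shift_eq \<sigma> m k (robin_shift \<sigma> m k)" using robin_shift[OF assms] by blast
    then show "equator_slope m \<mu> = \<sigma> * hyp m \<mu> (1/2)"
      using main[OF refl, of "robin_shift \<sigma> m k" k] unfolding k root_value_def shift_eq_def by blast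
  qed
qed

lemma robin_shift_range:
  assumes "\<sigma> \<ge> 0"
  shows "0 \<le> robin_shift \<sigma> m k" "robin_shift \<sigma> m k < 1/2"
  using robin_shift[OF assms, of m k "robin_shift \<sigma> m k"] by (auto simp: shift_eq_def)

text \<open>
  Divide the secular equation by the cosine and use \<open>x \<le> tan x\<close>. One Gamma quotient is at least its value
  \<open>1 / sqrt pi\<close> at \<open>0\<close>. The other has an argument of at least \<open>l / 2\<close>, where \<open>l = m + 2 k\<close>, and is at
  least \<open>sqrt (l / 2)\<close>. The remaining constant \<open>sqrt (pi / 2)\<close> exceeds \<open>1\<close>.
\<close>

lemma robin_shift_upper:
  assumes "\<sigma> \<ge> 0" "m + 2 * k \<ge> 1"
  shows "2 * robin_shift \<sigma> m k * sqrt (real (m + 2 * k)) \<le> \<sigma>"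
proof -
  define \<epsilon> where "\<epsilon> = robin_shift \<sigma> m k"
  define l where "l = m + 2 * k"
  have e: "0 \<le> \<epsilon>" "\<epsilon> < 1/2" using robin_shift_range[OF assms(1)] by (auto simp: \<epsilon>_def)
  have eq: "2 * sin (pi * \<epsilon>) * gamma_quot (real k + \<epsilon>) * gamma_quot (real m + real k + \<epsilon>) = \<sigma> * cos (pi * \<epsilon>)"
    using robin_shift[OF assms(1), of m k \<epsilon>] by (auto simp: \<epsilon>_def shift_eq_def)
  have r: "0 \<le> pi * \<epsilon>" "pi * \<epsilon> < pi/2" using e by auto
  have cpos: "cos (pi * \<epsilon>) > 0" using r by (intro cos_gt_zero_pi) linarith+
  \<comment> \<open>the inequality \<open>x \<le> tan x\<close>, proved by differentiating \<open>sin x - x cos x\<close>\<close>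
  have sc: "pi * \<epsilon> * cos (pi * \<epsilon>) \<le> sin (pi * \<epsilon>)"
  proof -
    have "(\<lambda>x. sin x - x * cos x) 0 \<le> (\<lambda>x. sin x - x * cos x) (pi * \<epsilon>)"
    proof (rule DERIV_nonneg_imp_nondecreasing[OF r(1)])
      fix x assume "0 \<le> x" "x \<le> pi * \<epsilon>"
      then have "0 \<le> x * sin x" using r pi_gt_zero by (intro mult_nonneg_nonneg sin_ge_zero) linarith+
      moreover have "((\<lambda>x. sin x - x * cos x) has_real_derivative x * sin x) (at x)"
        by (auto intro!: derivative_eq_intros)
      ultimately show "\<exists>y. ((\<lambda>x. sin x - x * cos x) has_real_derivative y) (at x) \<and> 0 \<le> y" by blast
    qed
    then show ?thesis by simp
  qed
  have g1: "1 / sqrt pi \<le> gamma_quot (real k + \<epsilon>)"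
    using gamma_quot_mono[of 0 "real k + \<epsilon>"] e by (simp add: gamma_quot_0)
  have snn: "0 \<le> sin (pi * \<epsilon>)" using r pi_gt_zero by (intro sin_ge_zero) linarith+
  have gnn: "0 \<le> gamma_quot (real k + \<epsilon>)" "0 \<le> gamma_quot (real m + real k + \<epsilon>)"
    using e by (auto intro!: less_imp_le[OF gamma_quot_pos])
  have l1: "real l \<ge> 1" using assms by (simp add: l_def)
  have "sqrt (real l / 2) \<le> gamma_quot (real l / 2)"
    using l1 by (intro gamma_quot_lower) simp
  also have "\<dots> \<le> gamma_quot (real m + real k + \<epsilon>)"
    using e by (intro gamma_quot_mono) (auto simp: l_def)
  finally have g2: "sqrt (real l / 2) \<le> gamma_quot (real m + real k + \<epsilon>)" .
  have "cos (pi * \<epsilon>) * (2 * (pi * \<epsilon>) * (1 / sqrt pi) * sqrt (real l / 2)) =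
      2 * (pi * \<epsilon> * cos (pi * \<epsilon>)) * (1 / sqrt pi) * sqrt (real l / 2)" by simp
  also have "\<dots> \<le> 2 * sin (pi * \<epsilon>) * gamma_quot (real k + \<epsilon>) * gamma_quot (real m + real k + \<epsilon>)"
    using sc g1 g2 e cpos
    using snn gnn by (intro mult_mono mult_nonneg_nonneg) auto
  also have "\<dots> = cos (pi * \<epsilon>) * \<sigma>" using eq by simp
  finally have "2 * (pi * \<epsilon>) * (1 / sqrt pi) * sqrt (real l / 2) \<le> \<sigma>"
    using cpos by (simp only: mult_le_cancel_left_pos)
  moreover have "2 * (pi * \<epsilon>) * (1 / sqrt pi) * sqrt (real l / 2) = 2 * \<epsilon> * sqrt (real l) * sqrt (pi / 2)"
  proof -
    have "2 * (pi * \<epsilon>) * (1 / sqrt pi) * sqrt (real l / 2) = 2 * \<epsilon> * (pi / sqrt pi) * sqrt (real l / 2)" by simp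
    also have "\<dots> = 2 * \<epsilon> * sqrt (real l) * sqrt (pi / 2)"
      using real_div_sqrt[of pi] by (simp add: real_sqrt_divide)
    finally show ?thesis .
  qed
  moreover have "2 * \<epsilon> * sqrt (real l) * 1 \<le> 2 * \<epsilon> * sqrt (real l) * sqrt (pi / 2)"
    using e pi_gt3 by (intro mult_left_mono) auto
  ultimately show ?thesis by (simp add: l_def \<epsilon>_def)
qed

text \<open>
  In the lowest state of the sector (\<open>k = 0\<close>) one Gamma quotient has an argument below \<open>1/2\<close> and is at most
  \<open>1\<close>, the other is at most \<open>sqrt (m + 1)\<close>. The size of \<open>m\<close> in terms of \<open>\<sigma>\<close> ensures, by the upper
  bound, that \<open>\<epsilon> \<le> 1/4\<close>, which keeps the cosine away from \<open>0\<close>.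
\<close>

lemma robin_shift_lower:
  assumes "\<sigma> \<ge> 0" "real m \<ge> 4 * \<sigma>\<^sup>2" "m \<ge> 1"
  shows "\<sigma> \<le> 4 * pi * robin_shift \<sigma> m 0 * sqrt (real m + 1)"
proof -
  define \<epsilon> where "\<epsilon> = robin_shift \<sigma> m 0"
  have e: "0 \<le> \<epsilon>" "\<epsilon> < 1/2" using robin_shift_range[OF assms(1)] by (auto simp: \<epsilon>_def)
  have eq: "2 * sin (pi * \<epsilon>) * gamma_quot \<epsilon> * gamma_quot (real m + \<epsilon>) = \<sigma> * cos (pi * \<epsilon>)"
    using robin_shift[OF assms(1), of m 0 \<epsilon>] by (auto simp: \<epsilon>_def shift_eq_def)
  have "2 * \<epsilon> * sqrt (real m) \<le> \<sigma>"
    using robin_shift_upper[of \<sigma> m 0] assms by (simp add: \<epsilon>_def)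
  also have "\<sigma> \<le> sqrt (real m) / 2"
  proof -
    have "sqrt ((2 * \<sigma>)\<^sup>2) \<le> sqrt (real m)" using assms(2) by (intro real_sqrt_le_mono) (simp add: power_mult_distrib)
    also have "sqrt ((2 * \<sigma>)\<^sup>2) = 2 * \<sigma>" using assms(1) by (intro real_sqrt_unique) auto
    finally show ?thesis by simp
  qed
  finally have "2 * \<epsilon> * sqrt (real m) \<le> (1/2) * sqrt (real m)" by simp
  moreover have "sqrt (real m) > 0" using assms(3) by simp
  ultimately have "2 * \<epsilon> \<le> 1/2" by (simp only: mult_le_cancel_right_pos)
  then have "cos (pi / 3) \<le> cos (pi * \<epsilon>)"
    using e pi_gt_zero by (intro cos_monotone_0_pi_le) auto
  then have "\<sigma> * (1/2) \<le> \<sigma> * cos (pi * \<epsilon>)" using assms(1) by (intro mult_left_mono) (auto simp: cos_60)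
  also have "\<dots> = 2 * sin (pi * \<epsilon>) * gamma_quot \<epsilon> * gamma_quot (real m + \<epsilon>)" using eq by simp
  also have "\<dots> \<le> 2 * (pi * \<epsilon>) * 1 * sqrt (real m + 1)"
  proof -
    have s: "0 \<le> 2 * sin (pi * \<epsilon>)" "2 * sin (pi * \<epsilon>) \<le> 2 * (pi * \<epsilon>)"
      using e pi_gt_zero by (auto intro!: sin_x_le_x sin_ge_zero)
    have g: "0 \<le> gamma_quot \<epsilon>" "0 \<le> gamma_quot (real m + \<epsilon>)"
      using e by (auto intro!: less_imp_le[OF gamma_quot_pos])
    have g1: "gamma_quot \<epsilon> \<le> 1"
      by (rule order_trans[OF gamma_quot_upper]) (use e in auto)
    have g2: "gamma_quot (real m + \<epsilon>) \<le> sqrt (real m + 1)"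
      by (rule order_trans[OF gamma_quot_upper]) (use e in auto)
    have "2 * sin (pi * \<epsilon>) * gamma_quot \<epsilon> \<le> 2 * (pi * \<epsilon>) * 1"
      using s g g1 e by (intro mult_mono) auto
    then show ?thesis using s g g1 g2 e by (intro mult_mono) auto
  qed
  finally show ?thesis by (simp add: \<epsilon>_def)
qed

section \<open>Gradients and the Laplacian of functions constant along rays\<close>

text \<open>
  Total differentiability with the derivative recorded by its partial derivatives. In this form the product and
  chain rules compute \<open>pderiv_at\<close> and keep the differentiability that these rules need.
\<close>

definition has_grad :: "(real^3 \<Rightarrow> complex) \<Rightarrow> (3 \<Rightarrow> complex) \<Rightarrow> real^3 \<Rightarrow> bool"
  where "has_grad G g x \<longleftrightarrow> (G has_derivative (\<lambda>h. \<Sum>i\<in>UNIV. of_real (h $ i) * g i)) (at x)"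

lemma has_grad_pderiv: "has_grad G g x \<Longrightarrow> pderiv_at i G x = g i"
proof -
  assume "has_grad G g x"
  then have "frechet_derivative G (at x) = (\<lambda>h. \<Sum>i\<in>UNIV. of_real (h $ i) * g i)"
    unfolding has_grad_def by (intro frechet_derivative_at[symmetric])
  then have "pderiv_at i G x = (\<Sum>j\<in>UNIV. of_real (axis i 1 $ j) * g j)"
    by (simp add: pderiv_at_def)
  also have "\<dots> = (\<Sum>j\<in>UNIV. if i = j then g j else 0)"
    by (intro sum.cong) (auto simp: axis_def)
  finally show ?thesis by simp
qed

lemma has_grad_pderiv_at:
  assumes "G differentiable (at x)"
  shows "has_grad G (\<lambda>i. pderiv_at i G x) x"
proof -
  let ?D = "frechet_derivative G (at x)"
  have D: "(G has_derivative ?D) (at x)" using assms frechet_derivative_works by blast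
  then have lin: "bounded_linear ?D" by (rule has_derivative_bounded_linear)
  have "?D h = (\<Sum>i\<in>UNIV. of_real (h $ i) * pderiv_at i G x)" for h
  proof -
    have "?D h = ?D (\<Sum>i\<in>UNIV. (h $ i) *\<^sub>R axis i 1)"
      using basis_expansion[of h] by (simp add: scalar_mult_eq_scaleR)
    also have "\<dots> = (\<Sum>i\<in>UNIV. (h $ i) *\<^sub>R ?D (axis i 1))"
      using bounded_linear.linear[OF lin] by (simp add: linear_sum linear_scale)
    finally show ?thesis by (simp add: pderiv_at_def scaleR_conv_of_real)
  qed
  then have "?D = (\<lambda>h. \<Sum>i\<in>UNIV. of_real (h $ i) * pderiv_at i G x)" by (rule ext)
  then show ?thesis using D unfolding has_grad_def by simp
qed

lemma has_grad_differentiable: "has_grad G g x \<Longrightarrow> G differentiable (at x)"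
  unfolding has_grad_def differentiable_def by blast

lemma has_grad_transform:
  assumes "open U" "x \<in> U" "\<And>y. y \<in> U \<Longrightarrow> G y = H y" "has_grad H g x"
  shows "has_grad G g x"
  using has_derivative_transform_within_open[OF assms(4)[unfolded has_grad_def] assms(1,2)] assms(3)
  unfolding has_grad_def by simp

lemma has_grad_cong: "has_grad G g x \<Longrightarrow> (\<And>i. g i = h i) \<Longrightarrow> has_grad G h x"
  by (simp add: has_grad_def)

lemma has_grad_eqI:
  assumes "has_grad H h x" "\<And>y. G y = H y" "\<And>i. g i = h i"
  shows "has_grad G g x"
proof -
  have "G = H" "g = h" using assms(2,3) by auto
  then show ?thesis using assms(1) by simp
qed

lemma has_grad_const: "has_grad (\<lambda>x. c) (\<lambda>i. 0) x"
  by (simp add: has_grad_def)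

lemma has_grad_add:
  assumes "has_grad G g x" "has_grad H h x"
  shows "has_grad (\<lambda>x. G x + H x) (\<lambda>i. g i + h i) x"
  using has_derivative_add[OF assms[unfolded has_grad_def]]
  by (simp add: has_grad_def algebra_simps sum.distrib)

lemma has_grad_mult:
  assumes "has_grad G g x" "has_grad H h x"
  shows "has_grad (\<lambda>x. G x * H x) (\<lambda>i. g i * H x + G x * h i) x"
  using has_derivative_mult[OF assms[unfolded has_grad_def]]
  by (simp add: has_grad_def algebra_simps sum.distrib sum_distrib_left)

lemma has_grad_cmult:
  assumes "has_grad G g x"
  shows "has_grad (\<lambda>x. c * G x) (\<lambda>i. c * g i) x"
  using has_grad_mult[OF has_grad_const assms, of c] by simp

lemma has_grad_power:
  assumes "has_grad G g x"
  shows "has_grad (\<lambda>x. G x ^ n) (\<lambda>i. of_nat n * G x ^ (n - 1) * g i) x"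
proof (induction n)
  case 0
  then show ?case using has_grad_const[of 1 x] by simp
next
  case (Suc n)
  have "has_grad (\<lambda>x. G x * G x ^ n) (\<lambda>i. g i * G x ^ n + G x * (of_nat n * G x ^ (n - 1) * g i)) x"
    by (rule has_grad_mult[OF assms Suc])
  then have "has_grad (\<lambda>x. G x * G x ^ n) (\<lambda>i. of_nat (Suc n) * G x ^ (Suc n - 1) * g i) x"
    by (rule has_grad_cong) (cases n; simp add: algebra_simps)
  then show ?case by simp
qed

lemma has_grad_coord: "has_grad (\<lambda>x. of_real (x $ j)) (\<lambda>i. if i = j then 1 else 0) x"
proof -
  have "(\<Sum>i\<in>UNIV. of_real (h $ i) * (if i = j then 1 else 0)) = (of_real (h $ j) :: complex)" for h :: "real^3"
    by (simp add: if_distrib cong: if_cong)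
  moreover have "bounded_linear (\<lambda>x :: real^3. complex_of_real (x $ j))"
    by (rule bounded_linear_compose[OF bounded_linear_of_real bounded_linear_vec_nth])
  ultimately show ?thesis
    by (simp add: has_grad_def bounded_linear_imp_has_derivative)
qed

lemma has_grad_compose_real:
  assumes f: "(f has_derivative (\<lambda>h. \<Sum>i\<in>UNIV. h $ i * p i)) (at x)"
    and v: "(v has_vector_derivative v') (at (f x))"
  shows "has_grad (\<lambda>x. v (f x)) (\<lambda>i. of_real (p i) * v') x"
proof -
  have "((\<lambda>x. v (f x)) has_derivative (\<lambda>h. (\<Sum>i\<in>UNIV. h $ i * p i) *\<^sub>R v')) (at x)"
    using has_derivative_compose[OF f v[unfolded has_vector_derivative_def]] .
  then show ?thesis
    by (simp add: has_grad_def scaleR_conv_of_real sum_distrib_right mult.assoc)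
qed

lemma has_grad_along_curve:
  assumes G: "has_grad G g (\<gamma> t)" and \<gamma>: "(\<gamma> has_vector_derivative \<gamma>') (at t)"
  shows "((\<lambda>t. G (\<gamma> t)) has_vector_derivative (\<Sum>i\<in>UNIV. of_real (\<gamma>' $ i) * g i)) (at t)"
proof -
  have "((\<lambda>t. G (\<gamma> t)) has_derivative (\<lambda>h. \<Sum>i\<in>UNIV. of_real ((h *\<^sub>R \<gamma>') $ i) * g i)) (at t)"
    using has_derivative_compose[OF \<gamma>[unfolded has_vector_derivative_def] G[unfolded has_grad_def]] .
  moreover have "(\<Sum>i\<in>UNIV. of_real ((h *\<^sub>R \<gamma>') $ i) * g i) = h *\<^sub>R (\<Sum>i\<in>UNIV. of_real (\<gamma>' $ i) * g i)" for h
    unfolding scaleR_sum_right by (intro sum.cong refl) (simp add: scaleR_conv_of_real[where 'a = complex])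
  ultimately show ?thesis
    by (simp add: has_vector_derivative_def)
qed

lemma inner_eq_sum_coord: "x \<bullet> h = (\<Sum>i\<in>UNIV. h $ i * x $ i)" for x h :: "real^3"
  by (simp add: inner_vec_def mult.commute)

lemma inverse_norm_derivative:
  assumes "x \<noteq> 0"
  shows "((\<lambda>x :: real^3. 1 / norm x) has_derivative (\<lambda>h. \<Sum>i\<in>UNIV. h $ i * (- x $ i / norm x ^ 3))) (at x)"
proof -
  have "((\<lambda>x :: real^3. inverse (norm x)) has_derivative (\<lambda>h. - (inverse (norm x) * (sgn x \<bullet> h) * inverse (norm x)))) (at x)"
  proof -
    have N: "(norm has_derivative (\<lambda>h. sgn x \<bullet> h)) (at x)" using has_derivative_norm[OF assms] by (simp add: inner_commute)
    show ?thesis by (rule Deriv.has_derivative_inverse[OF _ N]) (use assms in simp)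
  qed
  moreover have "- (inverse (norm x) * (sgn x \<bullet> h) * inverse (norm x)) = (\<Sum>i\<in>UNIV. h $ i * (- x $ i / norm x ^ 3))" for h
  proof -
    have "sgn x \<bullet> h = (\<Sum>i\<in>UNIV. h $ i * x $ i) / norm x"
      by (simp add: sgn_div_norm inner_eq_sum_coord[symmetric] divide_inverse)
    then have "- (inverse (norm x) * (sgn x \<bullet> h) * inverse (norm x)) = (\<Sum>i\<in>UNIV. h $ i * x $ i) * (- 1 / norm x ^ 3)"
      by (simp add: divide_inverse power3_eq_cube)
    also have "\<dots> = (\<Sum>i\<in>UNIV. h $ i * (- x $ i / norm x ^ 3))"
      unfolding sum_distrib_right by (intro sum.cong) auto
    finally show ?thesis .
  qed
  ultimately show ?thesis by (simp add: divide_inverse)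
qed

definition planar :: "real^3 \<Rightarrow> complex"
  where "planar x = of_real (x $ 1) + \<i> * of_real (x $ 2)"

definition planar_dir :: "3 \<Rightarrow> complex"
  where "planar_dir i = (if i = 1 then 1 else if i = 2 then \<i> else 0)"

definition inv_norm :: "real^3 \<Rightarrow> complex"
  where "inv_norm x = of_real (1 / norm x)"

definition height :: "real^3 \<Rightarrow> real"
  where "height x = x $ 3 / norm x"

lemma has_grad_planar: "has_grad planar planar_dir x"
proof -
  have "has_grad (\<lambda>x. of_real (x $ 1) + \<i> * of_real (x $ 2))
      (\<lambda>i. (if i = 1 then 1 else 0) + \<i> * (if i = 2 then 1 else 0)) x"
    by (intro has_grad_add has_grad_cmult has_grad_coord)
  then show ?thesis
    unfolding planar_def[abs_def] by (rule has_grad_cong) (auto simp: planar_dir_def)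
qed

lemma has_grad_inv_norm:
  assumes "x \<noteq> 0"
  shows "has_grad inv_norm (\<lambda>i. - of_real (x $ i) * inv_norm x ^ 3) x"
proof -
  have "has_grad (\<lambda>x. of_real (1 / norm x)) (\<lambda>i. of_real (- x $ i / norm x ^ 3) * 1) x"
    by (rule has_grad_compose_real[OF inverse_norm_derivative[OF assms]])
       (auto intro!: derivative_eq_intros)
  then show ?thesis
    unfolding inv_norm_def[abs_def] by (rule has_grad_cong) (simp add: power_divide)
qed

lemma height_derivative:
  assumes "x \<noteq> 0"
  shows "(height has_derivative (\<lambda>h. \<Sum>i\<in>UNIV. h $ i * ((if i = 3 then 1 else 0) / norm x - x $ 3 * x $ i / norm x ^ 3))) (at x)"
proof -
  have "((\<lambda>x. x $ 3 * (1 / norm x)) has_derivative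
      (\<lambda>h. x $ 3 * (\<Sum>i\<in>UNIV. h $ i * (- x $ i / norm x ^ 3)) + h $ 3 * (1 / norm x))) (at x)"
    by (intro has_derivative_mult inverse_norm_derivative assms bounded_linear_imp_has_derivative bounded_linear_vec_nth)
  moreover have "x $ 3 * (\<Sum>i\<in>UNIV. h $ i * (- x $ i / norm x ^ 3)) + h $ 3 * (1 / norm x) =
      (\<Sum>i\<in>UNIV. h $ i * ((if i = 3 then 1 else 0) / norm x - x $ 3 * x $ i / norm x ^ 3))" for h
    by (simp add: sum_3 algebra_simps)
  ultimately show ?thesis by (simp add: height_def[abs_def])
qed

text \<open>
  With \<open>w = x\<^sub>1 + \<i> x\<^sub>2\<close> and \<open>r = norm x\<close> this is \<open>w ^ a r ^ (- b) v(x\<^sub>3 / r)\<close>. For \<open>a = b\<close> it is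
  constant along rays. Two independent exponents are used because the family is then closed under partial
  derivatives, up to coordinate factors.
\<close>

definition cone_mode :: "nat \<Rightarrow> nat \<Rightarrow> (real \<Rightarrow> complex) \<Rightarrow> real^3 \<Rightarrow> complex"
  where "cone_mode a b v x = planar x ^ a * inv_norm x ^ b * v (height x)"

lemma has_grad_cone_mode:
  assumes "x \<noteq> 0" and v: "(v has_vector_derivative v' (height x)) (at (height x))"
  shows "has_grad (cone_mode a b v) (\<lambda>j. of_nat a * planar_dir j * cone_mode (a - 1) b v x
      - of_nat b * of_real (x $ j) * cone_mode a (b + 2) v x
      + (if j = 3 then 1 else 0) * cone_mode a (b + 1) v' x
      - of_real (x $ 3) * of_real (x $ j) * cone_mode a (b + 3) v' x) x"
proof -
  \<comment> \<open>for \<open>b = 0\<close> the truncated exponent is harmless because of the factor \<open>b\<close>\<close>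
  have pw: "of_nat b * inv_norm x ^ (b - 1) * inv_norm x ^ 3 = of_nat b * inv_norm x ^ (b + 2)"
    by (cases b) (auto simp: power_add eval_nat_numeral)
  have "has_grad (\<lambda>x. (planar x ^ a * inv_norm x ^ b) * v (height x))
     (\<lambda>j. ((of_nat a * planar x ^ (a - 1) * planar_dir j) * inv_norm x ^ b
       + planar x ^ a * (of_nat b * inv_norm x ^ (b - 1) * (- of_real (x $ j) * inv_norm x ^ 3))) * v (height x)
       + (planar x ^ a * inv_norm x ^ b) *
         (of_real ((if j = 3 then 1 else 0) / norm x - x $ 3 * x $ j / norm x ^ 3) * v' (height x))) x"
    by (intro has_grad_mult has_grad_power has_grad_planar has_grad_inv_norm has_grad_compose_real height_derivative assms)
  then show ?thesis
    unfolding cone_mode_def[abs_def]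
  proof (rule has_grad_cong)
    fix j :: 3
    let ?w = "planar x" and ?q = "inv_norm x" and ?d = "(if j = 3 then 1 else 0) :: complex"
    have d: "of_real ((if j = 3 then 1 else 0) / norm x - x $ 3 * x $ j / norm x ^ 3)
        = ?d * ?q - of_real (x $ 3) * of_real (x $ j) * ?q ^ 3"
      by (simp add: inv_norm_def power_divide)
    have "(of_nat a * ?w ^ (a - 1) * planar_dir j * ?q ^ b
       + ?w ^ a * (of_nat b * ?q ^ (b - 1) * (- of_real (x $ j) * ?q ^ 3))) * v (height x)
       + (?w ^ a * ?q ^ b) * ((?d * ?q - of_real (x $ 3) * of_real (x $ j) * ?q ^ 3) * v' (height x))
      = of_nat a * planar_dir j * (?w ^ (a - 1) * ?q ^ b * v (height x))
       - of_real (x $ j) * ?w ^ a * (of_nat b * ?q ^ (b - 1) * ?q ^ 3) * v (height x)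
       + ?d * (?w ^ a * ?q ^ (b + 1) * v' (height x))
       - of_real (x $ 3) * of_real (x $ j) * (?w ^ a * ?q ^ (b + 3) * v' (height x))"
      by (simp add: algebra_simps power_add)
    then show "(of_nat a * ?w ^ (a - 1) * planar_dir j * ?q ^ b
       + ?w ^ a * (of_nat b * ?q ^ (b - 1) * (- of_real (x $ j) * ?q ^ 3))) * v (height x)
       + (?w ^ a * ?q ^ b) * (of_real ((if j = 3 then 1 else 0) / norm x - x $ 3 * x $ j / norm x ^ 3) * v' (height x))
      = of_nat a * planar_dir j * (?w ^ (a - 1) * ?q ^ b * v (height x))
       - of_nat b * of_real (x $ j) * (?w ^ a * ?q ^ (b + 2) * v (height x))
       + ?d * (?w ^ a * ?q ^ (b + 1) * v' (height x))
       - of_real (x $ 3) * of_real (x $ j) * (?w ^ a * ?q ^ (b + 3) * v' (height x))"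
      unfolding d pw by (simp only: mult_ac)
  qed
qed

lemma C1_onI:
  assumes "\<And>x. x \<in> U \<Longrightarrow> has_grad G (\<lambda>i. g i x) x" "\<And>i. continuous_on U (g i)"
  shows "C1_on U G"
  unfolding C1_on_def
proof (intro conjI allI)
  show "G differentiable_on U"
    using assms(1) has_grad_differentiable
    by (meson differentiable_at_imp_differentiable_on)
  fix i
  have "pderiv_at i G x = g i x" if "x \<in> U" for x by (rule has_grad_pderiv[OF assms(1)[OF that]])
  then show "continuous_on U (pderiv_at i G)"
    using assms(2)[of i] by (simp cong: continuous_on_cong)
qed

context
  fixes U :: "(real^3) set" and I :: "real set" and v v' v'' :: "real \<Rightarrow> complex" and m :: nat and G :: "real^3 \<Rightarrow> complex"
  assumes U: "open U" and UI: "\<And>x. x \<in> U \<Longrightarrow> x \<noteq> 0 \<and> height x \<in> I"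
    and v: "\<And>z. z \<in> I \<Longrightarrow> (v has_vector_derivative v' z) (at z)"
    and v': "\<And>z. z \<in> I \<Longrightarrow> (v' has_vector_derivative v'' z) (at z)"
    and GU: "\<And>x. x \<in> U \<Longrightarrow> G x = cone_mode m m v x"
begin

private definition "first_partial i x = of_nat m * planar_dir i * cone_mode (m - 1) m v x
      - of_nat m * (of_real (x $ i) * cone_mode m (m + 2) v x)
      + (if i = 3 then 1 else 0) * cone_mode m (m + 1) v' x
      - of_real (x $ 3) * (of_real (x $ i) * cone_mode m (m + 3) v' x)" for i x

private definition "mode_partial a b (w :: real \<Rightarrow> complex) w' j x = of_nat a * planar_dir j * cone_mode (a - 1) b w x
      - of_nat b * of_real (x $ j) * cone_mode a (b + 2) w x
      + (if j = 3 then 1 else 0) * cone_mode a (b + 1) w' x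
      - of_real (x $ 3) * of_real (x $ j) * cone_mode a (b + 3) w' x" for a b w w' j x

private lemma mode_grad_v: "x \<in> U \<Longrightarrow> has_grad (cone_mode a b v) (\<lambda>j. mode_partial a b v v' j x) x"
  unfolding mode_partial_def using UI v by (intro has_grad_cone_mode) auto

private lemma mode_grad_v': "x \<in> U \<Longrightarrow> has_grad (cone_mode a b v') (\<lambda>j. mode_partial a b v' v'' j x) x"
  unfolding mode_partial_def using UI v' by (intro has_grad_cone_mode) auto

lemma cone_mode_grad: "x \<in> U \<Longrightarrow> has_grad G (\<lambda>i. first_partial i x) x"
  by (rule has_grad_transform[OF U _ GU]) (auto intro!: has_grad_cong[OF mode_grad_v] simp: first_partial_def mode_partial_def)

private definition "second_partial i j x = of_nat m * planar_dir i * mode_partial (m - 1) m v v' j x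
      - of_nat m * ((if j = i then 1 else 0) * cone_mode m (m + 2) v x + of_real (x $ i) * mode_partial m (m + 2) v v' j x)
      + (if i = 3 then 1 else 0) * mode_partial m (m + 1) v' v'' j x
      - ((if j = 3 then 1 else 0) * (of_real (x $ i) * cone_mode m (m + 3) v' x)
         + of_real (x $ 3) * ((if j = i then 1 else 0) * cone_mode m (m + 3) v' x + of_real (x $ i) * mode_partial m (m + 3) v' v'' j x))" for i j x

private lemma has_grad_first_partial: 
  assumes "x \<in> U" shows "has_grad (first_partial i) (\<lambda>j. second_partial i j x) x"
proof -
  have "has_grad (\<lambda>x. of_nat m * planar_dir i * cone_mode (m - 1) m v x
      + (- of_nat m) * (of_real (x $ i) * cone_mode m (m + 2) v x)
      + (if i = 3 then 1 else 0) * cone_mode m (m + 1) v' x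
      + (- 1) * (of_real (x $ 3) * (of_real (x $ i) * cone_mode m (m + 3) v' x)))
    (\<lambda>j. of_nat m * planar_dir i * mode_partial (m - 1) m v v' j x
      + (- of_nat m) * ((if j = i then 1 else 0) * cone_mode m (m + 2) v x + of_real (x $ i) * mode_partial m (m + 2) v v' j x)
      + (if i = 3 then 1 else 0) * mode_partial m (m + 1) v' v'' j x
      + (- 1) * ((if j = 3 then 1 else 0) * (of_real (x $ i) * cone_mode m (m + 3) v' x)
         + of_real (x $ 3) * ((if j = i then 1 else 0) * cone_mode m (m + 3) v' x + of_real (x $ i) * mode_partial m (m + 3) v' v'' j x))) x"
    by (intro has_grad_add has_grad_cmult has_grad_mult has_grad_coord mode_grad_v[OF assms] mode_grad_v'[OF assms])
  then show ?thesis
    by (rule has_grad_eqI) (simp_all only: first_partial_def second_partial_def diff_conv_add_uminus mult_minus_left mult_1)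
qed

private lemma pderiv_first: "x \<in> U \<Longrightarrow> pderiv_at i G x = first_partial i x"
  by (rule has_grad_pderiv[OF cone_mode_grad])

private lemma pderiv_second: "x \<in> U \<Longrightarrow> has_grad (pderiv_at i G) (\<lambda>j. second_partial i j x) x"
  by (rule has_grad_transform[OF U _ pderiv_first has_grad_first_partial])

text \<open>
  On the sphere, \<open>r = 1\<close> and the powers of \<open>r\<close> disappear. The terms with \<open>w ^ (m - 2)\<close> cancel because
  \<open>1 + \<i>\<^sup>2 = 0\<close>, and those with \<open>w ^ (m - 1)\<close> are multiples of \<open>w ^ m\<close> because the gradient of \<open>w\<close>
  contracted with \<open>x\<close> is \<open>w\<close>. What remains is the differential operator of the sector in \<open>z = x\<^sub>3\<close>.
\<close>

lemma laplacian_cone_mode: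
  assumes x: "x \<in> U" "norm x = 1"
  shows "laplacian G x = planar x ^ m * (of_real (1 - (x $ 3)\<^sup>2) * v'' (x $ 3)
     - of_real (2 * (real m + 1) * x $ 3) * v' (x $ 3) - of_real (real m * (real m + 1)) * v (x $ 3))"
proof -
  have q: "inv_norm x = 1" "height x = x $ 3" using x by (auto simp: inv_norm_def height_def)
  define w where "w = planar x"
  define X where "X = complex_of_real (x $ 1)"
  define Y where "Y = complex_of_real (x $ 2)"
  define Z where "Z = complex_of_real (x $ 3)"
  define P where "P = w ^ (m - 1)"
  define R where "R = w ^ (m - 1 - 1)"
  define M where "M = w ^ m"
  define n where "n = (of_nat m :: complex)"
  have w: "w = X + \<i> * Y" by (simp add: w_def planar_def X_def Y_def)
  have "(x $ 1)\<^sup>2 + (x $ 2)\<^sup>2 + (x $ 3)\<^sup>2 = 1"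
    using x(2) by (simp add: norm_vec_def L2_set_def sum_3)
  then have "complex_of_real ((x $ 1)\<^sup>2 + (x $ 2)\<^sup>2 + (x $ 3)\<^sup>2) = 1" by (simp only: of_real_1)
  then have S: "X\<^sup>2 + Y\<^sup>2 + Z\<^sup>2 = 1"
    by (simp add: X_def Y_def Z_def)
  have PM: "n * P * w = n * M" by (cases m) (auto simp: n_def P_def M_def)
  have "laplacian G x = (\<Sum>i\<in>UNIV. second_partial i i x)"
    unfolding laplacian_def using has_grad_pderiv[OF pderiv_second[OF x(1)]] by simp
  also have "\<dots> = M * ((1 - Z\<^sup>2) * v'' (x $ 3) - 2 * (n + 1) * Z * v' (x $ 3) - n * (n + 1) * v (x $ 3))"
  proof -
    define u where "u = v (x $ 3)"
    define u1 where "u1 = v' (x $ 3)"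
    define u2 where "u2 = v'' (x $ 3)"
    \<comment> \<open>Both factors in brackets on the right vanish: the first by \<open>S\<close>, the second by \<open>PM\<close>.
    Keeping \<open>P\<close> and \<open>M\<close> as unknowns avoids a separate treatment of small \<open>m\<close>.\<close>
    have "(\<Sum>i\<in>UNIV. second_partial i i x) - M * ((1 - Z\<^sup>2) * u2 - 2 * (n + 1) * Z * u1 - n * (n + 1) * u)
       = (n * (n + 2) * M * u + n * Z * M * u1 + Z * (n + 3) * M * u1 + Z\<^sup>2 * M * u2) * (X\<^sup>2 + Y\<^sup>2 + Z\<^sup>2 - 1)
         - 2 * (n * u + Z * u1) * (n * P * w - n * M)"
      unfolding sum_3 second_partial_def mode_partial_def cone_mode_def q power_one planar_dir_def
        w_def[symmetric] X_def[symmetric] Y_def[symmetric] Z_def[symmetric] u_def[symmetric] u1_def[symmetric]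
        u2_def[symmetric] P_def[symmetric] R_def[symmetric] M_def[symmetric] n_def[symmetric]
      unfolding w by (simp add: n_def[symmetric] algebra_simps power2_eq_square)
    then show ?thesis using S PM by (simp add: u_def u1_def u2_def)
  qed
  finally show ?thesis
    by (simp add: M_def w_def n_def Z_def)
qed

lemma C2_on_cone_mode:
  assumes cv: "continuous_on I v''"
  shows "C2_on U G"
proof -
  have cI: "continuous_on I v" "continuous_on I v'"
    using v v' by (auto intro!: continuous_at_imp_continuous_on has_vector_derivative_continuous)
  have nz: "norm x \<noteq> 0" if "x \<in> U" for x using UI[OF that] by simp
  have ch: "continuous_on U height"
    unfolding height_def[abs_def] using nz by (intro continuous_intros) auto
  have cc: "continuous_on U (cone_mode a b f)" if "continuous_on I f" for a b f
  proof -
    have "continuous_on U (\<lambda>x. f (height x))"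
      by (rule continuous_on_compose2[OF that ch]) (use UI in auto)
    then show ?thesis
      unfolding cone_mode_def[abs_def] inv_norm_def[abs_def] planar_def[abs_def]
      using nz by (intro continuous_intros) auto
  qed
  have "continuous_on U (first_partial i)" for i
    unfolding first_partial_def[abs_def] by (intro continuous_intros cc cI)
  then have "C1_on U G" by (intro C1_onI[OF cone_mode_grad])
  moreover have "continuous_on U (second_partial i j)" for i j
    unfolding second_partial_def[abs_def] mode_partial_def by (intro continuous_intros cc cI cv)
  then have "C1_on U (pderiv_at i G)" for i by (intro C1_onI[OF pderiv_second])
  ultimately show ?thesis unfolding C2_on_def by blast
qed

end

section \<open>The radial equation of a sector\<close>

text \<open>
  Up to a constant, \<open>(1 - z\<^sup>2) ^ (m / 2) * profile m \<mu> z\<close> is the associated Legendre function of order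
  \<open>- m\<close>. The profile is analytic at the pole \<open>z = 1\<close>; its derivatives \<open>profile'\<close> and \<open>profile''\<close> are
  profiles for \<open>m + 1\<close> and \<open>m + 2\<close> up to constants.
\<close>

definition profile :: "nat \<Rightarrow> real \<Rightarrow> real \<Rightarrow> real"
  where "profile m \<mu> z = hyp m \<mu> ((1 - z) / 2)"

definition profile' :: "nat \<Rightarrow> real \<Rightarrow> real \<Rightarrow> real"
  where "profile' m \<mu> z = - hyp_slope m \<mu> * profile (Suc m) \<mu> z / 2"

definition profile'' :: "nat \<Rightarrow> real \<Rightarrow> real \<Rightarrow> real"
  where "profile'' m \<mu> z = - hyp_slope m \<mu> * profile' (Suc m) \<mu> z / 2"

lemma profile_deriv:
  assumes "z \<in> {-1<..<3}"
  shows "(profile m \<mu> has_real_derivative profile' m \<mu> z) (at z)"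
proof -
  have h: "\<bar>(1 - z) / 2\<bar> < 1" using assms by auto
  have "((\<lambda>z. hyp m \<mu> ((1 - z) / 2)) has_real_derivative (hyp_slope m \<mu> * hyp (Suc m) \<mu> ((1 - z) / 2)) * (- 1 / 2)) (at z)"
    by (rule DERIV_chain2[where g = "\<lambda>z. (1 - z) / 2", OF hyp_deriv[OF h]]) (auto intro!: derivative_eq_intros)
  then show ?thesis by (simp add: profile_def[abs_def] profile'_def)
qed

lemma profile'_deriv:
  assumes "z \<in> {-1<..<3}"
  shows "(profile' m \<mu> has_real_derivative profile'' m \<mu> z) (at z)"
proof -
  have "profile' m \<mu> = (\<lambda>z. - hyp_slope m \<mu> * profile (Suc m) \<mu> z / 2)"
    by (rule ext) (rule profile'_def)
  then show ?thesis
    unfolding profile''_def by (auto intro!: derivative_eq_intros profile_deriv[OF assms])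
qed

lemma profile_ode:
  assumes "z \<in> {-1<..<3}"
  shows "(1 - z\<^sup>2) * profile'' m \<mu> z - 2 * (real m + 1) * z * profile' m \<mu> z + (\<mu> - real m * (real m + 1)) * profile m \<mu> z = 0"
proof -
  define t where "t = (1 - z) / 2"
  have z: "z = 1 - 2 * t" by (simp add: t_def field_simps)
  have t: "\<bar>t\<bar> < 1" using assms by (auto simp: t_def)
  define a where "a = hyp_slope m \<mu>"
  define b where "b = hyp_slope (Suc m) \<mu>"
  define y0 where "y0 = hyp m \<mu> t"
  define y1 where "y1 = hyp (Suc m) \<mu> t"
  define y2 where "y2 = hyp (Suc (Suc m)) \<mu> t"
  have mu: "\<mu> - real m * (real m + 1) = - (real m + 1) * a"
    by (simp add: a_def hyp_slope_def field_simps)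
  have "t * (1 - t) * (b * y2) + (real m + 1) * (1 - 2 * t) * y1 = (real m + 1) * y0"
    using hyp_contiguous[OF t] by (simp add: b_def y0_def y1_def y2_def)
  then have "a * (t * (1 - t) * (b * y2) + (real m + 1) * (1 - 2 * t) * y1 - (real m + 1) * y0) = 0"
    by simp
  moreover have "profile m \<mu> z = y0" "profile' m \<mu> z = - a * y1 / 2" "profile'' m \<mu> z = a * b * y2 / 4"
    by (simp_all add: profile_def profile'_def profile''_def a_def b_def y0_def y1_def y2_def flip: t_def)
  ultimately show ?thesis
    unfolding mu by (simp add: z algebra_simps power2_eq_square)
qed

lemma profile_at_1: "profile m \<mu> 1 = 1"
  by (simp add: profile_def)

lemma profile_at_0: "profile m \<mu> 0 = hyp m \<mu> (1/2)" "profile' m \<mu> 0 = equator_slope m \<mu>"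
  by (simp_all add: profile_def profile'_def equator_slope_def)

lemma profile_continuous_on: "continuous_on {-1<..<3} (profile m \<mu>)" "continuous_on {-1<..<3} (profile' m \<mu>)"
    "continuous_on {-1<..<3} (profile'' m \<mu>)"
proof -
  show c: "continuous_on {-1<..<3} (profile m \<mu>)" "continuous_on {-1<..<3} (profile' m \<mu>)" for m
    by (rule DERIV_continuous_on[OF has_field_derivative_at_within], rule profile_deriv profile'_deriv, assumption)+
  show "continuous_on {-1<..<3} (profile'' m \<mu>)"
    unfolding profile''_def[abs_def] by (auto intro!: continuous_intros c)
qed

lemma profile_nonzero_near_pole: "\<exists>z. 0 < z \<and> z < 1 \<and> profile m \<mu> z \<noteq> 0"
proof -
  have "isCont (profile m \<mu>) 1" by (rule DERIV_isCont[OF profile_deriv]) simp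
  then have "((profile m \<mu>) \<longlongrightarrow> 1) (at_left 1)"
    using profile_at_1[of m \<mu>] by (metis filterlim_at_split isCont_def)
  then have "eventually (\<lambda>z. profile m \<mu> z > 0) (at_left 1)"
    by (rule order_tendstoD) simp
  moreover have "eventually (\<lambda>z. z \<in> {0<..<1::real}) (at_left 1)"
    by (rule eventually_at_left_real) simp
  ultimately have "eventually (\<lambda>z. 0 < z \<and> z < 1 \<and> profile m \<mu> z \<noteq> 0) (at_left (1::real))"
    by eventually_elim auto
  then show ?thesis by (rule eventually_happens'[rotated]) simp
qed

section \<open>From the secular equation to eigenfunctions\<close>

lemma sph_coord: "sph \<theta> \<phi> $ 1 = sin \<theta> * cos \<phi>" "sph \<theta> \<phi> $ 2 = sin \<theta> * sin \<phi>" "sph \<theta> \<phi> $ 3 = cos \<theta>"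
  by (simp_all add: sph_def)

lemma norm_sph: "norm (sph \<theta> \<phi>) = 1"
proof -
  have "(sin \<theta> * cos \<phi>)\<^sup>2 + (sin \<theta> * sin \<phi>)\<^sup>2 + (cos \<theta>)\<^sup>2 = (sin \<theta>)\<^sup>2 * ((cos \<phi>)\<^sup>2 + (sin \<phi>)\<^sup>2) + (cos \<theta>)\<^sup>2"
    by (simp only: power_mult_distrib distrib_left)
  then have "(sin \<theta> * cos \<phi>)\<^sup>2 + (sin \<theta> * sin \<phi>)\<^sup>2 + (cos \<theta>)\<^sup>2 = 1"
    by simp
  then show ?thesis
    by (simp add: norm_vec_def L2_set_def sum_3 sph_coord)
qed

lemma planar_sph: "planar (sph \<theta> \<phi>) = of_real (sin \<theta>) * cis \<phi>"
  by (simp add: planar_def sph_coord complex_eq_iff)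

lemma exp_sector: "exp (\<i> * of_int (int m) * of_real \<phi>) = cis \<phi> ^ m"
proof -
  have "exp (\<i> * of_int (int m) * of_real \<phi>) = exp (of_nat m * (\<i> * of_real \<phi>))" by (simp add: mult_ac)
  then show ?thesis by (simp only: exp_of_nat_mult cis_conv_exp)
qed

text \<open>
  The factor \<open>(x + \<i> y) ^ m\<close> carries both the dependence on the longitude and the zero of order \<open>m\<close> at the
  pole, so that such a function is smooth at the pole as soon as \<open>v\<close> is smooth at \<open>1\<close>.
\<close>

definition sector_mode :: "nat \<Rightarrow> (real \<Rightarrow> complex) \<Rightarrow> real^3 \<Rightarrow> complex"
  where "sector_mode m v x = planar x ^ m * v (x $ 3)"

lemma sector_mode_sph: "sector_mode m v (sph \<theta> \<phi>) = of_real (sin \<theta> ^ m) * cis \<phi> ^ m * v (cos \<theta>)"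
  by (simp add: sector_mode_def planar_sph sph_coord power_mult_distrib)

lemma hom_ext_sector_mode: "hom_ext (sector_mode m v) x = cone_mode m m v x"
proof -
  have "planar (x /\<^sub>R norm x) = planar x * inv_norm x"
    by (simp add: planar_def inv_norm_def divide_inverse algebra_simps)
  then show ?thesis
    by (simp add: hom_ext_def sector_mode_def cone_mode_def height_def power_mult_distrib divide_inverse mult.commute)
qed

lemma height_range: "0 < x $ 3 \<Longrightarrow> x \<noteq> 0 \<and> 0 < height x \<and> height x \<le> 1"
proof -
  assume x: "0 < x $ 3"
  then have "x \<noteq> 0" by auto
  moreover have "x $ 3 \<le> norm x" using component_le_norm_cart[of x 3] by simp
  ultimately show ?thesis using x by (simp add: height_def divide_simps)
qed

lemma open_upper: "open {x :: real^3. 0 < x $ 3}"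
  by (intro open_Collect_less continuous_intros)

lemma meridian_derivative:
  "((\<lambda>\<theta>. of_real (sin \<theta> ^ m * profile m \<mu> (cos \<theta>)) * c) has_vector_derivative (of_real (- profile' m \<mu> 0) * c :: complex))
     (at (pi/2) within {0..pi/2})"
proof -
  have "((\<lambda>\<theta>. profile m \<mu> (cos \<theta>)) has_real_derivative profile' m \<mu> (cos (pi/2)) * (- sin (pi/2))) (at (pi/2))"
    by (rule DERIV_chain2[OF profile_deriv]) (auto intro!: derivative_eq_intros)
  then have "((\<lambda>\<theta>. sin \<theta> ^ m * profile m \<mu> (cos \<theta>)) has_real_derivative (- profile' m \<mu> 0)) (at (pi/2))"
    by (auto intro!: derivative_eq_intros)
  then have "((\<lambda>\<theta>. sin \<theta> ^ m * profile m \<mu> (cos \<theta>)) has_real_derivative (- profile' m \<mu> 0)) (at (pi/2) within {0..pi/2})"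
    by (rule has_field_derivative_at_within)
  then show ?thesis
    by (intro has_vector_derivative_mult_left has_vector_derivative_of_real)
qed

text \<open>
  The eigenfunction is the sector mode of the profile. Its extension along rays is a cone mode, so regularity and
  the eigenvalue equation, also at the pole, follow from the calculus of cone modes and from \<open>profile_ode\<close>.
\<close>

lemma sector_eigenvalueI:
  assumes bc: "equator_slope m \<mu> = \<sigma> * hyp m \<mu> (1/2)"
  shows "sector_eigenvalue \<sigma> (int m) \<mu>"
proof -
  let ?u = "\<lambda>z. complex_of_real (profile m \<mu> z)"
  let ?u' = "\<lambda>z. complex_of_real (profile' m \<mu> z)"
  let ?u'' = "\<lambda>z. complex_of_real (profile'' m \<mu> z)"
  define F where "F = sector_mode m ?u"
  let ?U = "{x :: real^3. 0 < x $ 3}"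
  have U: "x \<noteq> 0 \<and> height x \<in> {-1<..<3}" if "x \<in> ?U" for x
    using height_range[of x] that by auto
  have d1: "(?u has_vector_derivative ?u' z) (at z)" and d2: "(?u' has_vector_derivative ?u'' z) (at z)" if "z \<in> {-1<..<3}" for z
    using profile_deriv[OF that] profile'_deriv[OF that]
    by (auto intro!: has_vector_derivative_of_real simp: has_real_derivative_iff_has_vector_derivative)
  have ext: "hom_ext F x = cone_mode m m ?u x" for x
    unfolding F_def by (rule hom_ext_sector_mode)
  have cont: "continuous_on hemisphere F"
  proof -
    have "x $ 3 \<in> {-1<..<3}" if "x \<in> hemisphere" for x
      using that component_le_norm_cart[of x 3] by (auto simp: hemisphere_def)
    then have "continuous_on hemisphere (\<lambda>x. profile m \<mu> (x $ 3))"
      by (intro continuous_on_compose2[OF profile_continuous_on(1)] continuous_intros) auto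
    then show ?thesis
      unfolding F_def sector_mode_def[abs_def] planar_def[abs_def] by (intro continuous_intros)
  qed
  have C2: "C2_on ?U (hom_ext F)"
    by (rule C2_on_cone_mode[OF open_upper U d1 d2 ext]) (auto intro!: continuous_intros profile_continuous_on)
  have eq: "laplace_beltrami F x + of_real \<mu> * F x = 0" if "x \<in> open_hemisphere" for x
  proof -
    have x: "x \<in> ?U" "norm x = 1" using that by (auto simp: open_hemisphere_def)
    have z: "x $ 3 \<in> {-1<..<3}" using U[OF x(1)] x(2) by (simp add: height_def)
    have "laplacian (hom_ext F) x = planar x ^ m * (of_real (1 - (x $ 3)\<^sup>2) * ?u'' (x $ 3)
       - of_real (2 * (real m + 1) * x $ 3) * ?u' (x $ 3) - of_real (real m * (real m + 1)) * ?u (x $ 3))"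
      by (rule laplacian_cone_mode[OF open_upper U d1 d2 ext x])
    also have "\<dots> = planar x ^ m * of_real ((1 - (x $ 3)\<^sup>2) * profile'' m \<mu> (x $ 3)
       - 2 * (real m + 1) * x $ 3 * profile' m \<mu> (x $ 3) - real m * (real m + 1) * profile m \<mu> (x $ 3))"
      by (simp only: of_real_mult of_real_diff)
    also have "(1 - (x $ 3)\<^sup>2) * profile'' m \<mu> (x $ 3)
       - 2 * (real m + 1) * x $ 3 * profile' m \<mu> (x $ 3) - real m * (real m + 1) * profile m \<mu> (x $ 3) = - \<mu> * profile m \<mu> (x $ 3)"
      using profile_ode[OF z, of m \<mu>] by (simp add: algebra_simps)
    finally show ?thesis by (simp add: laplace_beltrami_def F_def sector_mode_def[of _ _ x])
  qed
  have bd: "((\<lambda>\<theta>. F (sph \<theta> \<phi>)) has_vector_derivative (- of_real (profile' m \<mu> 0) * cis \<phi> ^ m)) (at (pi/2) within {0..pi/2}) \<and>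
     - of_real (profile' m \<mu> 0) * cis \<phi> ^ m + of_real \<sigma> * F (sph (pi/2) \<phi>) = 0" for \<phi>
  proof
    have "((\<lambda>\<theta>. of_real (sin \<theta> ^ m * profile m \<mu> (cos \<theta>)) * cis \<phi> ^ m) has_vector_derivative of_real (- profile' m \<mu> 0) * cis \<phi> ^ m) (at (pi/2) within {0..pi/2})"
      by (rule meridian_derivative)
    then show "((\<lambda>\<theta>. F (sph \<theta> \<phi>)) has_vector_derivative (- of_real (profile' m \<mu> 0) * cis \<phi> ^ m)) (at (pi/2) within {0..pi/2})"
      by (simp add: F_def sector_mode_sph mult_ac)
    show "- of_real (profile' m \<mu> 0) * cis \<phi> ^ m + of_real \<sigma> * F (sph (pi/2) \<phi>) = 0"
      using bc by (simp add: F_def sector_mode_sph profile_at_0)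
  qed
  have "robin_solution \<sigma> \<mu> F"
    unfolding robin_solution_def using cont C2 eq bd by blast
  moreover have "in_sector (int m) F"
    unfolding in_sector_def
  proof (intro exI ballI)
    fix \<theta> \<phi> :: real assume "\<theta> \<in> {0..pi/2}" "\<phi> \<in> {0..<2*pi}"
    then have "sin \<theta> \<ge> 0" by (intro sin_ge_zero) auto
    then have "sqrt (1 - (cos \<theta>)\<^sup>2) = sin \<theta>" by (simp add: sin_squared_eq[symmetric])
    then show "F (sph \<theta> \<phi>) = exp (\<i> * of_int (int m) * of_real \<phi>) * (\<lambda>z. of_real (sqrt (1 - z\<^sup>2) ^ m * profile m \<mu> z)) (cos \<theta>)"
      unfolding exp_sector by (simp add: F_def sector_mode_sph)
  qed
  moreover have "\<exists>x\<in>hemisphere. F x \<noteq> 0"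
  proof -
    obtain z where z: "0 < z" "z < 1" "profile m \<mu> z \<noteq> 0" using profile_nonzero_near_pole by blast
    let ?x = "sph (arccos z) 0"
    have c: "cos (arccos z) = z" using z by (intro cos_arccos) auto
    have "arccos z \<noteq> 0" "0 < arccos z" "arccos z < pi" using z arccos_lt_bounded[of z] by auto
    then have "sin (arccos z) > 0" by (intro sin_gt_zero)
    then have "F ?x \<noteq> 0" using z c by (simp add: F_def sector_mode_sph)
    moreover have "?x \<in> hemisphere" using z c by (simp add: hemisphere_def norm_sph sph_coord)
    ultimately show ?thesis by blast
  qed
  ultimately show ?thesis unfolding sector_eigenvalue_def by blast
qed

section \<open>Uniqueness for linear equations and the meridian\<close>

text \<open>
  A Gronwall estimate: \<open>E = \<bar>h\<bar>\<^sup>2 + \<bar>h'\<bar>\<^sup>2\<close> satisfies \<open>\<bar>E'\<bar> \<le> K E\<close> on the compact segment from \<open>z0\<close> to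
  \<open>z\<close>, so \<open>E\<close> times \<open>exp (- K t)\<close> decreases and \<open>E\<close> times \<open>exp (K t)\<close> increases.
\<close>

lemma linear_ode_unique:
  fixes h h1 h2 :: "real \<Rightarrow> complex"
  assumes d1: "\<And>z. z \<in> {a<..<b} \<Longrightarrow> (h has_vector_derivative h1 z) (at z)"
    and d2: "\<And>z. z \<in> {a<..<b} \<Longrightarrow> (h1 has_vector_derivative h2 z) (at z)"
    and bound: "\<And>z. z \<in> {a<..<b} \<Longrightarrow> norm (h2 z) \<le> P z * (norm (h1 z) + norm (h z))"
    and P: "continuous_on {a<..<b} P"
    and z0: "z0 \<in> {a<..<b}" "h z0 = 0" "h1 z0 = 0" and z: "z \<in> {a<..<b}"
  shows "h z = 0"
proof -
  have sub: "closed_segment z0 z \<subseteq> {a<..<b}"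
    using z0(1) z by (intro closed_segment_subset) auto
  then have "compact (P ` closed_segment z0 z)"
    by (intro compact_continuous_image continuous_on_subset[OF P]) auto
  then obtain B where B: "\<And>t. t \<in> closed_segment z0 z \<Longrightarrow> P t \<le> B"
    by (meson bounded_imp_bdd_above bdd_above.unfold compact_imp_bounded imageI)
  define K where "K = 1 + 3 * \<bar>B\<bar>"
  define E where "E t = h t \<bullet> h t + h1 t \<bullet> h1 t" for t
  define E' where "E' t = 2 * (h t \<bullet> h1 t) + 2 * (h1 t \<bullet> h2 t)" for t
  have dE: "(E has_real_derivative E' t) (at t)" if "t \<in> {a<..<b}" for t
  proof -
    have "(E has_derivative (\<lambda>y. (h t \<bullet> (y *\<^sub>R h1 t) + (y *\<^sub>R h1 t) \<bullet> h t) + (h1 t \<bullet> (y *\<^sub>R h2 t) + (y *\<^sub>R h2 t) \<bullet> h1 t))) (at t)"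
      unfolding E_def[abs_def]
      using d1[OF that] d2[OF that] unfolding has_vector_derivative_def
      by (intro has_derivative_add has_derivative_inner)
    moreover have "(\<lambda>y. (h t \<bullet> (y *\<^sub>R h1 t) + (y *\<^sub>R h1 t) \<bullet> h t) + (h1 t \<bullet> (y *\<^sub>R h2 t) + (y *\<^sub>R h2 t) \<bullet> h1 t)) = (*) (E' t)"
      by (rule ext) (simp add: E'_def inner_commute algebra_simps)
    ultimately show ?thesis unfolding has_field_derivative_def by simp
  qed
  have est: "\<bar>E' t\<bar> \<le> K * E t" if t: "t \<in> closed_segment z0 z" for t
  proof -
    have tab: "t \<in> {a<..<b}" using t sub by blast
    define x where "x = norm (h t)"
    define y where "y = norm (h1 t)"
    have xy: "x \<ge> 0" "y \<ge> 0" by (auto simp: x_def y_def)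
    have "norm (h2 t) \<le> P t * (y + x)" using bound[OF tab] by (simp add: x_def y_def)
    also have "\<dots> \<le> \<bar>B\<bar> * (y + x)" using B[OF t] xy by (intro mult_right_mono) auto
    finally have n2: "norm (h2 t) \<le> \<bar>B\<bar> * (y + x)" .
    have "\<bar>E' t\<bar> \<le> 2 * \<bar>h t \<bullet> h1 t\<bar> + 2 * \<bar>h1 t \<bullet> h2 t\<bar>" unfolding E'_def by linarith
    also have "\<dots> \<le> 2 * (x * y) + 2 * (y * (\<bar>B\<bar> * (y + x)))"
      using Cauchy_Schwarz_ineq2[of "h t" "h1 t"] Cauchy_Schwarz_ineq2[of "h1 t" "h2 t"]
        mult_left_mono[OF n2 xy(2)] by (simp add: x_def y_def)
    also have "\<dots> = (1 + \<bar>B\<bar>) * (2 * (x * y)) + 2 * \<bar>B\<bar> * (y * y)" by (simp add: algebra_simps)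
    also have "\<dots> \<le> (1 + \<bar>B\<bar>) * (x * x + y * y) + 2 * \<bar>B\<bar> * (x * x + y * y)"
    proof (intro add_mono mult_left_mono)
      show "2 * (x * y) \<le> x * x + y * y"
        using zero_le_square[of "x - y"] by (simp add: algebra_simps)
    qed auto
    also have "\<dots> = K * E t"
      by (simp add: K_def E_def x_def y_def dot_square_norm power2_eq_square algebra_simps)
    finally show ?thesis .
  qed
  have E0: "E z0 = 0" using z0 by (simp add: E_def)
  have "E z \<le> 0"
  proof (cases "z0 \<le> z")
    case True
    have "E z * exp (- K * z) \<le> E z0 * exp (- K * z0)"
    proof (rule DERIV_nonpos_imp_nonincreasing[OF True])
      fix t assume "z0 \<le> t" "t \<le> z"
      then have t: "t \<in> closed_segment z0 z" using True by (simp add: closed_segment_eq_real_ivl)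
      have "((\<lambda>t. E t * exp (- K * t)) has_real_derivative (E' t - K * E t) * exp (- K * t)) (at t)"
        using t sub by (auto intro!: derivative_eq_intros dE simp: algebra_simps)
      moreover have "(E' t - K * E t) * exp (- K * t) \<le> 0"
        using est[OF t] by (intro mult_nonpos_nonneg) auto
      ultimately show "\<exists>y. ((\<lambda>t. E t * exp (- K * t)) has_real_derivative y) (at t) \<and> y \<le> 0" by blast
    qed
    then show ?thesis using E0 by (simp add: mult_le_0_iff)
  next
    case False
    then have le: "z \<le> z0" by simp
    have "E z * exp (K * z) \<le> E z0 * exp (K * z0)"
    proof (rule DERIV_nonneg_imp_nondecreasing[OF le])
      fix t assume "z \<le> t" "t \<le> z0"
      then have t: "t \<in> closed_segment z0 z" using le by (auto simp: closed_segment_eq_real_ivl)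
      have "((\<lambda>t. E t * exp (K * t)) has_real_derivative (E' t + K * E t) * exp (K * t)) (at t)"
        using t sub by (auto intro!: derivative_eq_intros dE simp: algebra_simps)
      moreover have "(E' t + K * E t) * exp (K * t) \<ge> 0"
        using est[OF t] by (intro mult_nonneg_nonneg) auto
      ultimately show "\<exists>y. ((\<lambda>t. E t * exp (K * t)) has_real_derivative y) (at t) \<and> 0 \<le> y" by blast
    qed
    then show ?thesis using E0 by (simp add: mult_le_0_iff)
  qed
  moreover have "0 \<le> h1 z \<bullet> h1 z" "0 \<le> h z \<bullet> h z" by simp_all
  ultimately have "h z \<bullet> h z = 0" unfolding E_def by linarith
  then show ?thesis by simp
qed

lemma hemisphere_polar:
  assumes "x \<in> hemisphere"
  obtains \<theta> \<phi> where "\<theta> \<in> {0..pi/2}" "\<phi> \<in> {0..<2*pi}" "x = sph \<theta> \<phi>"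
proof -
  have x: "norm x = 1" "0 \<le> x $ 3" using assms by (auto simp: hemisphere_def)
  have S: "(x $ 1)\<^sup>2 + (x $ 2)\<^sup>2 + (x $ 3)\<^sup>2 = 1"
    using x(1) by (simp add: norm_vec_def L2_set_def sum_3)
  have x3: "x $ 3 \<le> 1" using component_le_norm_cart[of x 3] x by simp
  define \<theta> where "\<theta> = arccos (x $ 3)"
  define \<phi> where "\<phi> = Arg2pi (planar x)"
  have th: "0 \<le> \<theta>" "\<theta> \<le> pi/2" "cos \<theta> = x $ 3"
    using x x3 arccos_lbound[of "x $ 3"] arccos_le_pi2[of "x $ 3"] cos_arccos[of "x $ 3"] by (auto simp: \<theta>_def)
  have s: "sin \<theta> = sqrt (1 - (x $ 3)\<^sup>2)"
    using x x3 unfolding \<theta>_def by (intro sin_arccos) auto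
  also have "1 - (x $ 3)\<^sup>2 = (x $ 1)\<^sup>2 + (x $ 2)\<^sup>2" using S by linarith
  also have "sqrt \<dots> = norm (planar x)" by (simp add: planar_def cmod_def)
  finally have "planar x = of_real (sin \<theta>) * cis \<phi>"
    using Arg2pi_eq[of "planar x"] by (simp add: \<phi>_def cis_conv_exp)
  then have "x $ 1 = sin \<theta> * cos \<phi>" "x $ 2 = sin \<theta> * sin \<phi>"
    by (simp_all add: planar_def complex_eq_iff)
  then have "x = sph \<theta> \<phi>"
    using th(3) by (simp add: vec_eq_iff forall_3 sph_coord)
  moreover have "\<phi> \<in> {0..<2*pi}" using Arg2pi_ge_0 Arg2pi_lt_2pi by (simp add: \<phi>_def)
  ultimately show thesis using th that by auto
qed

text \<open>
  The meridian \<open>\<phi> = 0\<close>, parametrised by the height \<open>z = cos \<theta>\<close> instead of \<open>\<theta>\<close>.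
\<close>

definition meridian :: "real \<Rightarrow> real^3"
  where "meridian z = sqrt (1 - z\<^sup>2) *\<^sub>R axis 1 1 + z *\<^sub>R axis 3 1"

lemma meridian_coord: "meridian z $ 1 = sqrt (1 - z\<^sup>2)" "meridian z $ 2 = 0" "meridian z $ 3 = z"
  by (simp_all add: meridian_def axis_def)

lemma meridian_sph: "0 \<le> sin \<theta> \<Longrightarrow> meridian (cos \<theta>) = sph \<theta> 0"
  by (simp add: vec_eq_iff forall_3 meridian_coord sph_coord sin_squared_eq[symmetric])

lemma norm_meridian: "\<bar>z\<bar> \<le> 1 \<Longrightarrow> norm (meridian z) = 1"
  by (simp add: norm_vec_def L2_set_def sum_3 meridian_coord abs_square_le_1)

lemma meridian_deriv:
  assumes "\<bar>z\<bar> < 1"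
  shows "(meridian has_vector_derivative ((- z / sqrt (1 - z\<^sup>2)) *\<^sub>R axis 1 1 + axis 3 1)) (at z)"
proof -
  have "1 - z\<^sup>2 > 0" using assms by (simp add: abs_square_less_1)
  then have "((\<lambda>z. sqrt (1 - z\<^sup>2)) has_real_derivative - z / sqrt (1 - z\<^sup>2)) (at z)"
    by (auto intro!: derivative_eq_intros simp: field_simps)
  then have "((\<lambda>z. sqrt (1 - z\<^sup>2) *\<^sub>R (axis 1 1 :: real^3)) has_vector_derivative (- z / sqrt (1 - z\<^sup>2)) *\<^sub>R axis 1 1) (at z)"
    using has_vector_derivative_scaleR[OF _ has_vector_derivative_const[of "axis 1 1 :: real^3"]] by fastforce
  moreover have "((\<lambda>z. z *\<^sub>R (axis 3 1 :: real^3)) has_vector_derivative 1 *\<^sub>R axis 3 1) (at z)"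
    using has_vector_derivative_scaleR[OF DERIV_ident has_vector_derivative_const[of "axis 3 1 :: real^3"]] by fastforce
  ultimately show ?thesis
    unfolding meridian_def[abs_def] using has_vector_derivative_add by fastforce
qed

lemma continuous_on_meridian: "continuous_on {-1..1} meridian"
  unfolding meridian_def[abs_def] by (intro continuous_intros)

section \<open>From eigenfunctions to the secular equation\<close>

text \<open>
  Abel's identity for the equation of the sector, whose weight is \<open>(1 - z\<^sup>2) ^ (m + 1)\<close>.
\<close>

lemma sector_wronskian_constant:
  fixes v v1 v2 :: "real \<Rightarrow> complex"
  assumes v: "(v has_vector_derivative v1 z) (at z)" "(v1 has_vector_derivative v2 z) (at z)"
    and ode: "of_real (1 - z\<^sup>2) * v2 z - of_real (2 * (real m + 1) * z) * v1 z
       + of_real (\<mu> - real m * (real m + 1)) * v z = 0"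
    and z: "z \<in> {0<..<1}"
  shows "((\<lambda>z. of_real ((1 - z\<^sup>2) ^ Suc m) * (v1 z * of_real (profile m \<mu> z) - v z * of_real (profile' m \<mu> z)))
    has_vector_derivative 0) (at z)"
proof -
  define u where "u = complex_of_real (profile m \<mu> z)"
  define u1 where "u1 = complex_of_real (profile' m \<mu> z)"
  define u2 where "u2 = complex_of_real (profile'' m \<mu> z)"
  define s where "s = complex_of_real (1 - z\<^sup>2)"
  define k where "k = complex_of_real (2 * (real m + 1) * z)"
  define c where "c = complex_of_real (\<mu> - real m * (real m + 1))"
  have zI: "z \<in> {-1<..<3}" using z by auto
  have du: "((\<lambda>z. complex_of_real (profile m \<mu> z)) has_vector_derivative u1) (at z)"
    "((\<lambda>z. complex_of_real (profile' m \<mu> z)) has_vector_derivative u2) (at z)"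
    using profile_deriv[OF zI] profile'_deriv[OF zI] by (auto intro!: has_vector_derivative_of_real simp: u1_def u2_def)
  have "((\<lambda>z. (1 - z\<^sup>2) ^ Suc m) has_real_derivative real (Suc m) * (1 - z\<^sup>2) ^ m * (- 2 * z)) (at z)"
  proof -
    have "((\<lambda>z. 1 - z\<^sup>2) has_real_derivative - 2 * z) (at z)" by (auto intro!: derivative_eq_intros)
    from DERIV_power[OF this, of "Suc m"] show ?thesis by (rule DERIV_cong) simp
  qed
  then have "((\<lambda>z. complex_of_real ((1 - z\<^sup>2) ^ Suc m)) has_vector_derivative of_real (real (Suc m) * (1 - z\<^sup>2) ^ m * (- 2 * z))) (at z)"
    by (rule has_vector_derivative_of_real)
  also have "complex_of_real (real (Suc m) * (1 - z\<^sup>2) ^ m * (- 2 * z)) = - (s ^ m) * k"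
    by (simp add: s_def k_def algebra_simps)
  finally have ds: "((\<lambda>z. complex_of_real ((1 - z\<^sup>2) ^ Suc m)) has_vector_derivative (- (s ^ m) * k)) (at z)" .
  have "((\<lambda>z. of_real ((1 - z\<^sup>2) ^ Suc m) * (v1 z * of_real (profile m \<mu> z) - v z * of_real (profile' m \<mu> z)))
     has_vector_derivative of_real ((1 - z\<^sup>2) ^ Suc m) * ((v1 z * u1 + v2 z * u) - (v z * u2 + v1 z * u1))
       + (- (s ^ m) * k) * (v1 z * u - v z * u1)) (at z)"
    unfolding u_def u1_def
    by (intro has_vector_derivative_mult has_vector_derivative_diff ds v du[unfolded u1_def])
  also have "of_real ((1 - z\<^sup>2) ^ Suc m) * ((v1 z * u1 + v2 z * u) - (v z * u2 + v1 z * u1))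
       + (- (s ^ m) * k) * (v1 z * u - v z * u1) =
     s ^ m * ((s * v2 z - k * v1 z + c * v z) * u - v z * (s * u2 - k * u1 + c * u))"
  proof -
    have e: "complex_of_real ((1 - z\<^sup>2) ^ Suc m) = s * s ^ m" by (simp only: s_def of_real_power of_real_mult power_Suc)
    show ?thesis unfolding e by (simp add: algebra_simps)
  qed
  also have "s * v2 z - k * v1 z + c * v z = 0" using ode by (simp only: s_def k_def c_def)
  also have "s * u2 - k * u1 + c * u = 0"
  proof -
    have "complex_of_real ((1 - z\<^sup>2) * profile'' m \<mu> z - 2 * (real m + 1) * z * profile' m \<mu> z + (\<mu> - real m * (real m + 1)) * profile m \<mu> z) = 0"
      using profile_ode[OF zI, of m \<mu>] by (simp only: of_real_0)
    then show ?thesis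
      by (simp only: of_real_mult of_real_diff of_real_add s_def k_def c_def u_def u1_def u2_def)
  qed
  finally show ?thesis by simp
qed

text \<open>
  The limits at \<open>z = 1\<close> exclude the second, singular solution: they force the weighted Wronskian of \<open>v\<close> and
  the profile to vanish. At a point where the profile does not vanish, the Cauchy data of \<open>v\<close> are therefore
  proportional to those of the profile, and uniqueness spreads the proportionality to the whole interval.
\<close>

lemma sector_ode_multiple:
  fixes v v1 v2 :: "real \<Rightarrow> complex"
  assumes v: "\<And>z. z \<in> {0<..<1} \<Longrightarrow> (v has_vector_derivative v1 z) (at z)"
      "\<And>z. z \<in> {0<..<1} \<Longrightarrow> (v1 has_vector_derivative v2 z) (at z)"
    and ode: "\<And>z. z \<in> {0<..<1} \<Longrightarrow> of_real (1 - z\<^sup>2) * v2 z - of_real (2 * (real m + 1) * z) * v1 z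
       + of_real (\<mu> - real m * (real m + 1)) * v z = 0"
    and lim: "((\<lambda>z. of_real ((1 - z\<^sup>2) ^ Suc m) * v1 z) \<longlongrightarrow> 0) (at_left 1)"
      "((\<lambda>z. of_real ((1 - z\<^sup>2) ^ Suc m) * v z) \<longlongrightarrow> 0) (at_left 1)"
  shows "\<exists>c. \<forall>z\<in>{0<..<1}. v z = c * of_real (profile m \<mu> z)"
proof -
  define W where "W z = of_real ((1 - z\<^sup>2) ^ Suc m) * (v1 z * of_real (profile m \<mu> z) - v z * of_real (profile' m \<mu> z))" for z
  have dW: "(W has_vector_derivative 0) (at z within {0<..<1})" if z: "z \<in> {0<..<1}" for z
    unfolding W_def[abs_def]
    by (rule has_vector_derivative_at_within, rule sector_wronskian_constant[where v = v and ?v1.0 = v1 and ?v2.0 = v2, OF v(1)[OF z] v(2)[OF z] ode[OF z] z])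
  have "\<exists>w. \<forall>z\<in>{0<..<1}. W z = w"
  proof (rule has_derivative_zero_constant)
    show "convex {0<..<1::real}" by simp
    show "(W has_derivative (\<lambda>h. 0)) (at z within {0<..<1})" if "z \<in> {0<..<1}" for z
      using dW[OF that] by (simp add: has_vector_derivative_def)
  qed
  then obtain w where w: "\<And>z. z \<in> {0<..<1} \<Longrightarrow> W z = w" by blast
  have isC: "isCont (profile m \<mu>) 1" "isCont (profile' m \<mu>) 1"
    using DERIV_isCont[OF profile_deriv] DERIV_isCont[OF profile'_deriv] by simp_all
  have L: "((profile m \<mu>) \<longlongrightarrow> profile m \<mu> 1) (at_left 1)" "((profile' m \<mu>) \<longlongrightarrow> profile' m \<mu> 1) (at_left 1)"
    using isC unfolding isCont_def filterlim_at_split by auto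
  have "((\<lambda>z. (of_real ((1 - z\<^sup>2) ^ Suc m) * v1 z) * of_real (profile m \<mu> z) - (of_real ((1 - z\<^sup>2) ^ Suc m) * v z) * of_real (profile' m \<mu> z))
     \<longlongrightarrow> 0 * of_real (profile m \<mu> 1) - 0 * of_real (profile' m \<mu> 1)) (at_left 1)"
    by (intro tendsto_diff tendsto_mult lim tendsto_of_real L)
  then have "(W \<longlongrightarrow> 0) (at_left 1)"
    by (simp add: W_def[abs_def] algebra_simps)
  moreover have "eventually (\<lambda>z. z \<in> {0<..<1::real}) (at_left 1)"
    by (rule eventually_at_left_real) simp
  then have "eventually (\<lambda>z. W z = w) (at_left 1)"
    by eventually_elim (rule w)
  then have "(W \<longlongrightarrow> w) (at_left 1)" by (rule tendsto_eventually)
  ultimately have w0: "w = 0" using tendsto_unique[OF trivial_limit_at_left_real] by blast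
  have W0: "v1 z * of_real (profile m \<mu> z) = v z * of_real (profile' m \<mu> z)" if "z \<in> {0<..<1}" for z
  proof -
    have "1 - z\<^sup>2 \<noteq> 0" using that abs_square_less_1[of z] by auto
    then show ?thesis using w[OF that] unfolding W_def w0 by (simp del: of_real_power of_real_diff of_real_mult)
  qed
  obtain z0 where z0: "0 < z0" "z0 < 1" "profile m \<mu> z0 \<noteq> 0" using profile_nonzero_near_pole by blast
  define c where "c = v z0 / of_real (profile m \<mu> z0)"
  have "v z - c * of_real (profile m \<mu> z) = 0" if z: "z \<in> {0<..<1}" for z
  proof (rule linear_ode_unique[where h = "\<lambda>z. v z - c * of_real (profile m \<mu> z)" and ?h1.0 = "\<lambda>z. v1 z - c * of_real (profile' m \<mu> z)"
        and ?h2.0 = "\<lambda>z. v2 z - c * of_real (profile'' m \<mu> z)" and a = "0" and b = "1" and ?z0.0 = z0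
        and P = "\<lambda>z. (2 * (real m + 1) + \<bar>\<mu> - real m * (real m + 1)\<bar>) / (1 - z\<^sup>2)"])
    fix z :: real assume z: "z \<in> {0<..<1}"
    then have zI: "z \<in> {-1<..<3}" by auto
    show "((\<lambda>z. v z - c * of_real (profile m \<mu> z)) has_vector_derivative v1 z - c * of_real (profile' m \<mu> z)) (at z)"
      by (intro has_vector_derivative_diff has_vector_derivative_mult_right has_vector_derivative_of_real v(1) z profile_deriv zI)
    show "((\<lambda>z. v1 z - c * of_real (profile' m \<mu> z)) has_vector_derivative v2 z - c * of_real (profile'' m \<mu> z)) (at z)"
      by (intro has_vector_derivative_diff has_vector_derivative_mult_right has_vector_derivative_of_real v(2) z profile'_deriv zI)
    define h where "h = v z - c * of_real (profile m \<mu> z)"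
    define h1 where "h1 = v1 z - c * of_real (profile' m \<mu> z)"
    define h2 where "h2 = v2 z - c * of_real (profile'' m \<mu> z)"
    define s where "s = 1 - z\<^sup>2"
    define d where "d = \<mu> - real m * (real m + 1)"
    have s: "s > 0" using z abs_square_less_1[of z] by (auto simp: s_def)
    have "complex_of_real (s * profile'' m \<mu> z - 2 * (real m + 1) * z * profile' m \<mu> z + d * profile m \<mu> z) = 0"
      using profile_ode[OF zI, of m \<mu>] unfolding s_def d_def by (simp only: of_real_0)
    then have A: "of_real s * of_real (profile'' m \<mu> z) - of_real (2 * (real m + 1) * z) * of_real (profile' m \<mu> z)
        + of_real d * of_real (profile m \<mu> z) = (0 :: complex)"
      by (simp only: of_real_mult of_real_diff of_real_add)
    have B: "of_real s * v2 z - of_real (2 * (real m + 1) * z) * v1 z + of_real d * v z = 0"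
      using ode[OF z] unfolding s_def d_def .
    have "S * (w2 - c * u2) - (K * (w1 - c * u1) - D * (w - c * u)) = (S * w2 - K * w1 + D * w) - c * (S * u2 - K * u1 + D * u)"
      for S K D w w1 w2 u u1 u2 :: complex by (simp add: algebra_simps)
    from this[of "of_real s" "v2 z" "of_real (profile'' m \<mu> z)" "of_real (2 * (real m + 1) * z)" "v1 z" "of_real (profile' m \<mu> z)"
        "of_real d" "v z" "of_real (profile m \<mu> z)", unfolded A B]
    have "of_real s * h2 = of_real (2 * (real m + 1) * z) * h1 - of_real d * h"
      unfolding h_def h1_def h2_def by simp
    then have "norm (of_real s * h2) \<le> norm (of_real (2 * (real m + 1) * z) * h1) + norm (of_real d * h)"
      by (metis norm_triangle_ineq4)
    also have "\<dots> = 2 * (real m + 1) * z * norm h1 + \<bar>d\<bar> * norm h"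
      using z by (simp add: norm_mult abs_mult del: of_real_mult of_real_add)
    also have "\<dots> \<le> (2 * (real m + 1) + \<bar>d\<bar>) * norm h1 + (2 * (real m + 1) + \<bar>d\<bar>) * norm h"
    proof (intro add_mono mult_right_mono)
      have "2 * (real m + 1) * z \<le> 2 * (real m + 1) * 1" using z by (intro mult_left_mono) auto
      then show "2 * (real m + 1) * z \<le> 2 * (real m + 1) + \<bar>d\<bar>" by linarith
    qed auto
    finally have "s * norm h2 \<le> (2 * (real m + 1) + \<bar>d\<bar>) * (norm h1 + norm h)"
      using s by (simp add: norm_mult algebra_simps)
    then show "norm h2 \<le> (2 * (real m + 1) + \<bar>\<mu> - real m * (real m + 1)\<bar>) / (1 - z\<^sup>2) * (norm h1 + norm h)"
      using s unfolding s_def[symmetric] d_def[symmetric] by (simp add: field_simps)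
  next
    have "1 - z\<^sup>2 \<noteq> 0" if "z \<in> {0<..<1}" for z :: real
      using that abs_square_less_1[of z] by auto
    then show "continuous_on {0<..<1} (\<lambda>z. (2 * (real m + 1) + \<bar>\<mu> - real m * (real m + 1)\<bar>) / (1 - z\<^sup>2))"
      by (intro continuous_intros) auto
    show "v z0 - c * of_real (profile m \<mu> z0) = 0" using z0 by (simp add: c_def)
    show "v1 z0 - c * of_real (profile' m \<mu> z0) = 0" using W0[of z0] z0 by (simp add: c_def field_simps)
  qed (use z z0 in auto)
  then show ?thesis by auto
qed

text \<open>
  An eigenfunction \<open>F\<close> of the sector is determined by its restriction \<open>p\<close> to a meridian. Off the axis, \<open>F\<close>
  extends to a cone mode whose profile is \<open>v = p / (1 - z\<^sup>2) ^ (m / 2)\<close>, so \<open>v\<close> solves the equation of the sector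
  on \<open>(0, 1)\<close>. Continuous differentiability at the pole bounds \<open>sqrt (1 - z\<^sup>2) p'(z)\<close> there, which yields the limits
  required by \<open>sector_ode_multiple\<close>. Continuity then carries \<open>v = c profile\<close> to the equator, where the Robin
  condition for \<open>F\<close> becomes that for the profile.
\<close>

lemma sector_eigenvalueD:
  assumes "sector_eigenvalue \<sigma> (int m) \<mu>"
  shows "equator_slope m \<mu> = \<sigma> * hyp m \<mu> (1/2)"
proof -
  obtain F where rs: "robin_solution \<sigma> \<mu> F" and sec: "in_sector (int m) F" and nz: "\<exists>x\<in>hemisphere. F x \<noteq> 0"
    using assms unfolding sector_eigenvalue_def by blast
  let ?U = "{x :: real^3. 0 < x $ 3}"
  define G where "G = hom_ext F"
  have contF: "continuous_on hemisphere F" and C2: "C2_on ?U G"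
    and pde: "\<And>x. x \<in> open_hemisphere \<Longrightarrow> laplacian G x + of_real \<mu> * F x = 0"
    and bc: "\<exists>D. ((\<lambda>\<theta>. F (sph \<theta> 0)) has_vector_derivative D) (at (pi/2) within {0..pi/2}) \<and>
             D + of_real \<sigma> * F (sph (pi/2) 0) = 0"
    using rs unfolding robin_solution_def G_def laplace_beltrami_def by blast+
  obtain f where f: "\<And>\<theta> \<phi>. \<theta> \<in> {0..pi/2} \<Longrightarrow> \<phi> \<in> {0..<2*pi} \<Longrightarrow> F (sph \<theta> \<phi>) = cis \<phi> ^ m * f (cos \<theta>)"
    using sec unfolding in_sector_def exp_sector by blast
  define p where "p z = F (meridian z)" for z
  have sin0: "sin \<theta> \<ge> 0" if "\<theta> \<in> {0..pi/2}" for \<theta> using that by (intro sin_ge_zero) auto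
  have Fp: "F (sph \<theta> \<phi>) = cis \<phi> ^ m * p (cos \<theta>)" if "\<theta> \<in> {0..pi/2}" "\<phi> \<in> {0..<2*pi}" for \<theta> \<phi>
    using f[OF that] f[OF that(1), of 0] meridian_sph[OF sin0[OF that(1)]] by (simp add: p_def)
  have mer_hemi: "meridian z \<in> hemisphere" if "z \<in> {0..1}" for z
    using that norm_meridian[of z] by (simp add: hemisphere_def meridian_coord)
  have contp: "continuous_on {0..1} p"
    unfolding p_def[abs_def]
    by (rule continuous_on_compose2[OF contF continuous_on_subset[OF continuous_on_meridian]]) (use mer_hemi in auto)
  have pG: "p z = G (meridian z)" if "z \<in> {0..1}" for z
    using that norm_meridian[of z] by (simp add: p_def G_def hom_ext_def)

  define s where "s z = sqrt (1 - z\<^sup>2)" for z :: real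
  have s_pos: "s z > 0" if "z \<in> {0<..<1}" for z
    using that abs_square_less_1[of z] by (auto simp: s_def)
  have C1: "C1_on ?U G" and C1': "\<And>i. C1_on ?U (pderiv_at i G)" using C2 by (auto simp: C2_on_def)
  have grad: "has_grad H (\<lambda>i. pderiv_at i H x) x" if "C1_on ?U H" "0 < x $ 3" for H x
    using that open_upper unfolding C1_on_def
    by (intro has_grad_pderiv_at) (auto simp: differentiable_on_eq_differentiable_at)
  have curve: "((\<lambda>z. H (meridian z)) has_vector_derivative
      (of_real (- z / s z) * pderiv_at 1 H (meridian z) + pderiv_at 3 H (meridian z))) (at z)"
    if H: "C1_on ?U H" and z: "z \<in> {0<..<1}" for H z
    using has_grad_along_curve[OF grad[OF H] meridian_deriv, of z] z
    by (simp add: meridian_coord sum_3 axis_def s_def)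
  define p1 where "p1 z = of_real (- z / s z) * pderiv_at 1 G (meridian z) + pderiv_at 3 G (meridian z)" for z
  have dp: "(p has_vector_derivative p1 z) (at z)" if z: "z \<in> {0<..<1}" for z
    by (rule has_vector_derivative_transform_within_open[OF curve[OF C1 z, folded p1_def], of "{0<..<1}"])
       (use z pG in auto)
  have ds: "(s has_real_derivative - z / s z) (at z)" if z: "z \<in> {0<..<1}" for z
  proof -
    have "1 - z\<^sup>2 > 0" using s_pos[OF z] by (simp add: s_def)
    then show ?thesis unfolding s_def[abs_def] by (auto intro!: derivative_eq_intros simp: field_simps)
  qed
  have dp1: "p1 differentiable (at z)" if z: "z \<in> {0<..<1}" for z
  proof -
    have "((\<lambda>z. - z / s z) has_real_derivative ((- 1) * s z - (- z) * (- z / s z)) / (s z * s z)) (at z)"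
    proof (rule DERIV_divide[OF _ ds[OF z]])
      show "((\<lambda>z. - z) has_real_derivative - 1) (at z)" by (auto intro!: derivative_eq_intros)
      show "s z \<noteq> 0" using s_pos[OF z] by simp
    qed
    then have "((\<lambda>z. complex_of_real (- z / s z)) has_vector_derivative of_real (((- 1) * s z - (- z) * (- z / s z)) / (s z * s z))) (at z)"
      by (rule has_vector_derivative_of_real)
    from has_vector_derivative_add[OF has_vector_derivative_mult[OF this curve[OF C1'[of 1] z]] curve[OF C1'[of 3] z]]
    show ?thesis unfolding p1_def[abs_def] by (rule differentiableI_vector)
  qed
  define p2 where "p2 z = vector_derivative p1 (at z)" for z
  have dp1': "(p1 has_vector_derivative p2 z) (at z)" if "z \<in> {0<..<1}" for z
    using dp1[OF that] unfolding p2_def by (simp add: vector_derivative_works)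

  define r where "r z = 1 / s z ^ m" for z
  define r1 where "r1 z = real m * z / s z ^ (m + 2)" for z
  define r2 where "r2 z = (real m * s z ^ (m + 2) - real m * z * (real (m + 2) * s z ^ (m + 1) * (- z / s z))) / (s z ^ (m + 2) * s z ^ (m + 2))" for z
  have dr: "(r has_real_derivative r1 z) (at z)" if z: "z \<in> {0<..<1}" for z
  proof -
    have "((\<lambda>z. 1 / s z ^ m) has_real_derivative - (real m * s z ^ (m - 1) * (- z / s z)) / (s z ^ m * s z ^ m)) (at z)"
      using s_pos[OF z] by (auto intro!: derivative_eq_intros ds z)
    also have "- (real m * s z ^ (m - 1) * (- z / s z)) / (s z ^ m * s z ^ m) = r1 z"
      using s_pos[OF z] by (cases m) (simp_all add: r1_def field_simps)
    finally show ?thesis by (simp add: r_def[abs_def])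
  qed
  have dr1: "(r1 has_real_derivative r2 z) (at z)" if z: "z \<in> {0<..<1}" for z
    unfolding r1_def[abs_def] r2_def
    using s_pos[OF z] by (auto intro!: derivative_eq_intros ds z simp del: power_Suc)
  define v where "v z = of_real (r z) * p z" for z
  define v1 where "v1 z = of_real (r z) * p1 z + of_real (r1 z) * p z" for z
  define v2 where "v2 z = (of_real (r z) * p2 z + of_real (r1 z) * p1 z) + (of_real (r1 z) * p1 z + of_real (r2 z) * p z)" for z
  have dv: "(v has_vector_derivative v1 z) (at z)" if z: "z \<in> {0<..<1}" for z
    unfolding v_def[abs_def] v1_def
    by (intro has_vector_derivative_mult has_vector_derivative_of_real dr dp z)
  have dv1: "(v1 has_vector_derivative v2 z) (at z)" if z: "z \<in> {0<..<1}" for z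
    unfolding v1_def[abs_def] v2_def
    by (intro has_vector_derivative_add has_vector_derivative_mult has_vector_derivative_of_real dr dr1 dp dp1' z)

  define V where "V = {x :: real^3. 0 < x $ 3 \<and> planar x \<noteq> 0}"
  have openV: "open V"
    unfolding V_def planar_def
    by (intro open_Collect_conj open_Collect_less open_Collect_neq continuous_intros)
  have Vh: "x \<noteq> 0 \<and> height x \<in> {0<..<1}" if "x \<in> V" for x
  proof -
    have x: "0 < x $ 3" "planar x \<noteq> 0" using that by (auto simp: V_def)
    have "height x \<noteq> 1"
    proof
      assume "height x = 1"
      then have "x $ 3 = norm x" using height_range[OF x(1)] by (simp add: height_def)
      moreover have "(norm x)\<^sup>2 = (x $ 1)\<^sup>2 + (x $ 2)\<^sup>2 + (x $ 3)\<^sup>2"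
        by (simp add: norm_vec_def L2_set_def sum_3)
      ultimately have "(x $ 1)\<^sup>2 + (x $ 2)\<^sup>2 = 0" by simp
      then have "x $ 1 = 0 \<and> x $ 2 = 0" by (simp only: sum_power2_eq_zero_iff)
      then show False using x(2) by (simp add: planar_def)
    qed
    then show ?thesis using height_range[OF x(1)] by auto
  qed
  have GV: "G x = cone_mode m m v x" if "x \<in> V" for x
  proof -
    let ?y = "x /\<^sub>R norm x"
    have x: "0 < x $ 3" "planar x \<noteq> 0" using that by (auto simp: V_def)
    have "?y \<in> hemisphere" using Vh[OF that] x by (simp add: hemisphere_def)
    then obtain \<theta> \<phi> where y: "\<theta> \<in> {0..pi/2}" "\<phi> \<in> {0..<2*pi}" "?y = sph \<theta> \<phi>"
      by (rule hemisphere_polar)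
    have "cos \<theta> = height x" using y(3) sph_coord(3)[of \<theta> \<phi>] by (simp add: height_def divide_inverse mult.commute flip: y(3))
    then have c: "cos \<theta> \<in> {0<..<1}" using Vh[OF that] by simp
    have "s (cos \<theta>) = sin \<theta>" using sin0[OF y(1)] by (simp add: s_def sin_squared_eq[symmetric])
    then have "of_real (sin \<theta> ^ m) * v (cos \<theta>) = p (cos \<theta>)"
      using s_pos[OF c] by (simp add: v_def r_def)
    then have "sector_mode m v ?y = cis \<phi> ^ m * p (cos \<theta>)"
      unfolding y(3) sector_mode_sph by (simp add: mult_ac)
    also have "\<dots> = F ?y" unfolding y(3) by (rule Fp[OF y(1,2), symmetric])
    finally show ?thesis
      using hom_ext_sector_mode[of m v x] by (simp add: G_def hom_ext_def)
  qed
  have ode: "of_real (1 - z\<^sup>2) * v2 z - of_real (2 * (real m + 1) * z) * v1 z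
       + of_real (\<mu> - real m * (real m + 1)) * v z = 0" if z: "z \<in> {0<..<1}" for z
  proof -
    let ?x = "meridian z"
    have nx: "norm ?x = 1" using z by (intro norm_meridian) auto
    have pl: "planar ?x = of_real (s z)" by (simp add: planar_def meridian_coord s_def)
    have xV: "?x \<in> V" using z s_pos[OF z] by (simp add: V_def pl meridian_coord)
    have lap: "laplacian G ?x = planar ?x ^ m * (of_real (1 - (?x $ 3)\<^sup>2) * v2 (?x $ 3)
     - of_real (2 * (real m + 1) * ?x $ 3) * v1 (?x $ 3) - of_real (real m * (real m + 1)) * v (?x $ 3))"
      by (rule laplacian_cone_mode[OF openV Vh dv dv1 GV xV nx])
    have "?x \<in> open_hemisphere" using z nx by (simp add: open_hemisphere_def meridian_coord)
    from pde[OF this] have "laplacian G ?x + of_real \<mu> * F ?x = 0" .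
    moreover have "F ?x = planar ?x ^ m * v z"
      using s_pos[OF z] by (simp add: pl v_def r_def p_def)
    ultimately have "planar ?x ^ m * (of_real (1 - z\<^sup>2) * v2 z
     - of_real (2 * (real m + 1) * z) * v1 z + of_real (\<mu> - real m * (real m + 1)) * v z) = 0"
      unfolding lap by (simp add: meridian_coord algebra_simps)
    moreover have "planar ?x ^ m \<noteq> 0" using s_pos[OF z] by (simp add: pl)
    ultimately show ?thesis by (simp only: mult_eq_0_iff simp_thms)
  qed

  have near1: "eventually (\<lambda>z. z \<in> {0<..<1::real}) (at_left 1)"
    by (rule eventually_at_left_real) simp
  have at1: "at 1 within {0..1} = at_left (1::real)"
    by (rule at_within_nhd[of _ "{0<..}"]) auto
  have limp: "(p \<longlongrightarrow> p 1) (at_left 1)"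
    using contp[unfolded continuous_on_def, rule_format, of 1] unfolding at1 by simp
  have s0: "(s \<longlongrightarrow> 0) (at_left 1)"
  proof -
    have "((\<lambda>z. sqrt (1 - z\<^sup>2)) \<longlongrightarrow> sqrt (1 - 1\<^sup>2)) (at_left 1)" by (intro tendsto_intros)
    then show ?thesis by (simp add: s_def[abs_def])
  qed
  have idl: "((\<lambda>z. z) \<longlongrightarrow> (1::real)) (at_left 1)" by (intro tendsto_intros)
  have limpd: "((\<lambda>z. pderiv_at i G (meridian z)) \<longlongrightarrow> pderiv_at i G (meridian 1)) (at_left 1)" for i
  proof -
    have c: "continuous_on {0<..1} (\<lambda>z. pderiv_at i G (meridian z))"
      by (rule continuous_on_compose2[of ?U, OF _ continuous_on_subset[OF continuous_on_meridian]])
         (use C1 in \<open>auto simp: C1_on_def meridian_coord\<close>)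
    have a: "at 1 within {0<..1} = at_left (1::real)"
      by (rule at_within_nhd[of _ "{0<..}"]) auto
    show ?thesis using c[unfolded continuous_on_def, rule_format, of 1] unfolding a by simp
  qed
  have ss: "s z * s z = 1 - z\<^sup>2" if "z \<in> {0<..<1}" for z
    using s_pos[OF that] by (simp add: s_def)
  have e0: "of_real ((1 - z\<^sup>2) ^ Suc m) * v z = of_real (s z ^ (m + 2)) * p z" if z: "z \<in> {0<..<1}" for z
  proof -
    have "(1 - z\<^sup>2) ^ Suc m * r z = s z ^ (m + 2)"
      unfolding ss[OF z, symmetric] r_def using s_pos[OF z] by (simp add: power_mult_distrib field_simps)
    then show ?thesis unfolding v_def by (simp only: mult.assoc[symmetric] of_real_mult[symmetric])
  qed
  have e1: "of_real ((1 - z\<^sup>2) ^ Suc m) * v1 z = of_real (s z ^ (m + 1)) * (of_real (- z) * pderiv_at 1 G (meridian z) + of_real (s z) * pderiv_at 3 G (meridian z))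
      + of_real (real m * z * s z ^ m) * p z" if z: "z \<in> {0<..<1}" for z
  proof -
    have a: "(1 - z\<^sup>2) ^ Suc m * r z = s z ^ (m + 1) * s z"
      unfolding ss[OF z, symmetric] r_def using s_pos[OF z] by (simp add: power_mult_distrib field_simps)
    have b: "(1 - z\<^sup>2) ^ Suc m * r1 z = real m * z * s z ^ m"
      unfolding ss[OF z, symmetric] r1_def using s_pos[OF z] by (simp add: power_mult_distrib field_simps)
    have c: "of_real (s z) * p1 z = of_real (- z) * pderiv_at 1 G (meridian z) + of_real (s z) * pderiv_at 3 G (meridian z)"
      unfolding p1_def using s_pos[OF z] by (simp add: field_simps)
    have "of_real ((1 - z\<^sup>2) ^ Suc m) * v1 z = of_real ((1 - z\<^sup>2) ^ Suc m * r z) * p1 z + of_real ((1 - z\<^sup>2) ^ Suc m * r1 z) * p z"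
      unfolding v1_def by (simp only: distrib_left mult.assoc of_real_mult)
    also have "\<dots> = of_real (s z ^ (m + 1)) * (of_real (s z) * p1 z) + of_real (real m * z * s z ^ m) * p z"
      unfolding a b by (simp only: of_real_mult mult.assoc)
    finally show ?thesis unfolding c .
  qed
  \<comment> \<open>for \<open>m = 0\<close> it is the factor \<open>m\<close> that vanishes, not the power of \<open>s\<close>\<close>
  have ms0: "((\<lambda>z. real m * z * s z ^ m) \<longlongrightarrow> 0) (at_left 1)"
  proof (cases m)
    case (Suc k)
    have "((\<lambda>z. real m * z * s z ^ m) \<longlongrightarrow> real m * 1 * 0 ^ m) (at_left 1)"
      by (intro tendsto_intros s0)
    then show ?thesis by (simp add: Suc)
  qed simp
  have lim0: "((\<lambda>z. of_real ((1 - z\<^sup>2) ^ Suc m) * v z) \<longlongrightarrow> 0) (at_left 1)"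
  proof -
    have "((\<lambda>z. of_real (s z ^ (m + 2)) * p z) \<longlongrightarrow> of_real (0 ^ (m + 2)) * p 1) (at_left 1)"
      by (intro tendsto_mult tendsto_of_real tendsto_power s0 limp)
    moreover have "eventually (\<lambda>z. of_real (s z ^ (m + 2)) * p z = of_real ((1 - z\<^sup>2) ^ Suc m) * v z) (at_left 1)"
      using near1 by eventually_elim (rule e0[symmetric])
    ultimately show ?thesis by (subst (asm) tendsto_cong) (auto simp: power_add)
  qed
  have lim1: "((\<lambda>z. of_real ((1 - z\<^sup>2) ^ Suc m) * v1 z) \<longlongrightarrow> 0) (at_left 1)"
  proof -
    have "((\<lambda>z. of_real (s z ^ (m + 1)) * (of_real (- z) * pderiv_at 1 G (meridian z) + of_real (s z) * pderiv_at 3 G (meridian z))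
      + of_real (real m * z * s z ^ m) * p z) \<longlongrightarrow>
       of_real (0 ^ (m + 1)) * (of_real (- 1) * pderiv_at 1 G (meridian 1) + of_real 0 * pderiv_at 3 G (meridian 1)) + of_real 0 * p 1) (at_left 1)"
      by (intro tendsto_add tendsto_mult tendsto_of_real tendsto_power tendsto_minus s0 limp limpd idl ms0)
    moreover have "eventually (\<lambda>z. of_real (s z ^ (m + 1)) * (of_real (- z) * pderiv_at 1 G (meridian z) + of_real (s z) * pderiv_at 3 G (meridian z))
      + of_real (real m * z * s z ^ m) * p z = of_real ((1 - z\<^sup>2) ^ Suc m) * v1 z) (at_left 1)"
      using near1 by eventually_elim (rule e1[symmetric])
    ultimately show ?thesis by (subst (asm) tendsto_cong) auto
  qed
  obtain c where c: "\<And>z. z \<in> {0<..<1} \<Longrightarrow> v z = c * of_real (profile m \<mu> z)"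
    using sector_ode_multiple[OF dv dv1 ode lim1 lim0] by blast
  have pc: "p z = c * of_real (s z ^ m * profile m \<mu> z)" if "z \<in> {0..1}" for z
  proof -
    let ?d = "\<lambda>z. p z - c * of_real (s z ^ m * profile m \<mu> z)"
    have "continuous_on {0..1} (\<lambda>z. profile m \<mu> z)"
      by (rule continuous_on_subset[OF profile_continuous_on(1)]) auto
    then have "continuous_on (closure {0<..<1}) ?d"
      unfolding s_def by (auto intro!: continuous_intros contp)
    moreover have "?d z = 0" if z: "z \<in> {0<..<1}" for z
    proof -
      have "p z = of_real (s z ^ m) * v z" using s_pos[OF z] by (simp add: v_def r_def)
      then show ?thesis using c[OF z] by simp
    qed
    moreover have "z \<in> closure {0<..<1}" using that by simp
    ultimately have "?d z = 0" by (rule continuous_constant_on_closure[where f = ?d])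
    then show ?thesis by simp
  qed
  have c0: "c \<noteq> 0"
  proof
    assume "c = 0"
    then have p0: "p z = 0" if "z \<in> {0..1}" for z using pc[OF that] by simp
    obtain x where x: "x \<in> hemisphere" "F x \<noteq> 0" using nz by blast
    obtain \<theta> \<phi> where y: "\<theta> \<in> {0..pi/2}" "\<phi> \<in> {0..<2*pi}" "x = sph \<theta> \<phi>"
      by (rule hemisphere_polar[OF x(1)])
    have "cos \<theta> \<in> {0..1}" using y(1) by (auto intro!: cos_ge_zero)
    then show False using x(2) Fp[OF y(1,2)] p0 y(3) by simp
  qed
  have Fc: "F (sph \<theta> 0) = of_real (sin \<theta> ^ m * profile m \<mu> (cos \<theta>)) * c" if "\<theta> \<in> {0..pi/2}" for \<theta>
  proof -
    have "cos \<theta> \<in> {0..1}" using that by (auto intro!: cos_ge_zero)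
    moreover have "s (cos \<theta>) = sin \<theta>" using sin0[OF that] by (simp add: s_def sin_squared_eq[symmetric])
    ultimately show ?thesis using Fp[OF that, of 0] pc[of "cos \<theta>"] by simp
  qed
  obtain D where D: "((\<lambda>\<theta>. F (sph \<theta> 0)) has_vector_derivative D) (at (pi/2) within {0..pi/2})"
      "D + of_real \<sigma> * F (sph (pi/2) 0) = 0" using bc by blast
  have "((\<lambda>\<theta>. F (sph \<theta> 0)) has_vector_derivative of_real (- profile' m \<mu> 0) * c) (at (pi/2) within {0..pi/2})"
    by (rule has_vector_derivative_transform[OF _ Fc meridian_derivative]) auto
  then have "D = of_real (- profile' m \<mu> 0) * c"
    using vector_derivative_unique_within_closed_interval[of 0 "pi/2" "pi/2"] D(1) by (auto simp: cbox_interval)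
  then have "of_real (- profile' m \<mu> 0) * c + of_real \<sigma> * (of_real (profile m \<mu> 0) * c) = 0"
    using D(2) Fc[of "pi/2"] by simp
  then have "c * of_real (\<sigma> * profile m \<mu> 0 - profile' m \<mu> 0) = 0"
    by (simp add: algebra_simps)
  then have "\<sigma> * profile m \<mu> 0 - profile' m \<mu> 0 = 0" using c0 by (simp only: mult_eq_0_iff of_real_eq_0_iff simp_thms)
  then show ?thesis by (simp add: profile_at_0)
qed

lemma desym_spectrum_eq:
  assumes "\<sigma> \<ge> 0"
  shows "desym_spectrum \<sigma> = range (\<lambda>(m, k). (m, root_value (m + 2 * k) (robin_shift \<sigma> m k)))"
proof -
  have "sector_eigenvalue \<sigma> (int m) \<mu> \<longleftrightarrow> (\<exists>k. \<mu> = root_value (m + 2 * k) (robin_shift \<sigma> m k))" for m \<mu>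
    using sector_eigenvalueI sector_eigenvalueD sector_roots[OF assms] by metis
  then show ?thesis unfolding desym_spectrum_def by (auto simp: image_iff)
qed

section \<open>Sorted enumerations\<close>

text \<open>
  Order \<open>A\<close> by the second and then by the first component, and map each element to the number of its
  predecessors. This rank is finite by assumption, injective, and onto the natural numbers because its range is infinite
  and downward closed. Its inverse is the enumeration.
\<close>

lemma exists_sorted_enumeration:
  fixes A :: "(nat \<times> real) set"
  assumes inf: "infinite A" and fin: "\<And>x. finite {p \<in> A. snd p < x}"
  shows "\<exists>l. mono l \<and> (\<exists>s. bij_betw (\<lambda>n :: nat. (s n, l n)) UNIV A)"
proof -
  define less where "less q p \<longleftrightarrow> snd q < snd p \<or> snd q = snd p \<and> fst q < fst p" for q p :: "nat \<times> real"
  have trans: "less a c" if "less a b" "less b c" for a b c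
    using that by (auto simp: less_def)
  have irrefl: "\<not> less a a" for a by (auto simp: less_def)
  have total: "less a b \<or> a = b \<or> less b a" for a b
    by (auto simp: less_def prod_eq_iff)
  define below where "below p = {q \<in> A. less q p}" for p
  define r where "r p = card (below p)" for p
  have fin_below: "finite (below p)" for p
    by (rule finite_subset[OF _ fin[of "snd p + 1"]]) (auto simp: below_def less_def)
  have r_mono: "r p < r p'" if "p \<in> A" "less p p'" for p p'
    unfolding r_def
  proof (rule psubset_card_mono[OF fin_below])
    show "below p \<subset> below p'"
      unfolding below_def using that trans[OF _ that(2)] irrefl by blast
  qed
  have r_inj: "inj_on r A"
  proof (rule inj_onI)
    fix a b assume ab: "a \<in> A" "b \<in> A" "r a = r b"
    show "a = b"
      using total[of a b] r_mono[OF ab(1), of b] r_mono[OF ab(2), of a] ab(3) by auto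
  qed
  have onto: "r ` below p = {..<r p}" if "p \<in> A" for p
  proof (rule card_subset_eq)
    show "r ` below p \<subseteq> {..<r p}"
      using r_mono unfolding below_def by blast
    show "card (r ` below p) = card {..<r p}"
    proof -
      have "inj_on r (below p)" by (rule inj_on_subset[OF r_inj]) (auto simp: below_def)
      then show ?thesis by (simp add: card_image r_def[of p])
    qed
  qed simp
  have r_surj: "r ` A = UNIV"
  proof -
    have "n \<in> r ` A" for n
    proof -
      have "infinite (r ` A)" using inf finite_image_iff[OF r_inj] by simp
      then obtain j where j: "j > n" "j \<in> r ` A"
        unfolding infinite_nat_iff_unbounded by blast
      then obtain p where p: "p \<in> A" "r p > n" by blast
      then have "n \<in> r ` below p" using onto[OF p(1)] by simp
      then show ?thesis by (auto simp: below_def)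
    qed
    then show ?thesis by blast
  qed
  define e where "e = inv_into A r"
  have e: "bij_betw e UNIV A"
    unfolding e_def using bij_betw_inv_into[of r A UNIV] r_inj r_surj by (simp add: bij_betw_def)
  have re: "r (e n) = n" and eA: "e n \<in> A" for n
    unfolding e_def using f_inv_into_f[of n r A] inv_into_into[of n r A] r_surj by simp_all
  have "mono (\<lambda>n. snd (e n))"
  proof (rule monoI, rule ccontr)
    fix n n' :: nat assume "n \<le> n'" "\<not> snd (e n) \<le> snd (e n')"
    then have "r (e n') < r (e n)" by (intro r_mono eA) (simp add: less_def)
    then show False using re \<open>n \<le> n'\<close> by simp
  qed
  moreover have "bij_betw (\<lambda>n. (fst (e n), snd (e n))) UNIV A" using e by simp
  ultimately show ?thesis
    by (intro exI[of _ "\<lambda>n. snd (e n)"] conjI exI[of _ "\<lambda>n. fst (e n)"])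
qed

text \<open>
  A sorted enumeration is determined by the counting function of the set. This gives the uniqueness behind
  \<open>robin_ev\<close> and allows two spectra to be compared by counting.
\<close>

lemma sorted_enumeration_less_iff:
  fixes A :: "(nat \<times> real) set"
  assumes "mono l" and bij: "bij_betw (\<lambda>n :: nat. (s n, l n)) UNIV A"
    and fin: "finite {p \<in> A. snd p < x}"
  shows "l n < x \<longleftrightarrow> n < card {p \<in> A. snd p < x}"
proof -
  let ?N = "{n. l n < x}"
  have im: "(\<lambda>n. (s n, l n)) ` ?N = {p \<in> A. snd p < x}"
    using bij by (auto simp: bij_betw_def)
  have inj: "inj_on (\<lambda>n. (s n, l n)) ?N"
    using bij by (auto simp: bij_betw_def intro: inj_on_subset)
  have finN: "finite ?N" using fin im inj by (metis finite_imageD)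
  have card: "card ?N = card {p \<in> A. snd p < x}" using card_image[OF inj] im by simp
  have down: "j \<in> ?N" if "i \<in> ?N" "j \<le> i" for i j
    using that monoD[OF assms(1) that(2)] by auto
  have "?N = {..<card ?N}"
  proof (cases "?N = {}")
    case False
    then have "?N = {..Max ?N}"
    proof (intro set_eqI iffI)
      fix j assume "j \<in> {..Max ?N}"
      then show "j \<in> ?N" using down[OF Max_in[OF finN False]] by blast
    qed (use Max_ge[OF finN] in blast)
    then show ?thesis by (metis card_atMost lessThan_Suc_atMost)
  next
    case True
    then show ?thesis by simp
  qed
  then show ?thesis using card by auto
qed

section \<open>Clusters of eigenvalues\<close>

lemma root_value_bounds:
  assumes "0 \<le> \<epsilon>" "\<epsilon> < 1/2"
  shows "real l * (real l + 1) \<le> root_value l \<epsilon>" "root_value l \<epsilon> < (real l + 1) * (real l + 2)"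
proof -
  show "real l * (real l + 1) \<le> root_value l \<epsilon>"
    unfolding root_value_def using assms by (intro mult_mono) auto
  show "root_value l \<epsilon> < (real l + 1) * (real l + 2)"
    unfolding root_value_def using assms by (intro mult_strict_mono) auto
qed

lemma root_value_zero: "root_value l 0 = real l * (real l + 1)"
  by (simp add: root_value_def)

lemma level_mono: "l \<le> l' \<Longrightarrow> real l * (real l + 1) \<le> real l' * (real l' + 1)"
  by (intro mult_mono) auto

lemma root_value_less_iff:
  assumes "0 \<le> \<epsilon>" "\<epsilon> < 1/2"
  shows "root_value l \<epsilon> < real l' * (real l' + 1) \<longleftrightarrow> l < l'"
proof
  assume "root_value l \<epsilon> < real l' * (real l' + 1)"
  then show "l < l'"
    using root_value_bounds(1)[OF assms, of l] level_mono[of l' l] by force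
next
  assume "l < l'"
  then have "real (Suc l) * (real (Suc l) + 1) \<le> real l' * (real l' + 1)" by (intro level_mono) simp
  then show "root_value l \<epsilon> < real l' * (real l' + 1)"
    using root_value_bounds(2)[OF assms, of l] by (simp add: add_ac)
qed

definition spectrum_param :: "real \<Rightarrow> nat \<times> nat \<Rightarrow> nat \<times> real"
  where "spectrum_param \<sigma> = (\<lambda>(m, k). (m, root_value (m + 2 * k) (robin_shift \<sigma> m k)))"

lemma root_value_level_unique:
  assumes "0 \<le> \<epsilon>" "\<epsilon> < 1/2" "0 \<le> \<epsilon>'" "\<epsilon>' < 1/2" "root_value l \<epsilon> = root_value l' \<epsilon>'"
  shows "l = l'"
proof -
  have "l < j \<longleftrightarrow> l' < j" for j
    using root_value_less_iff[OF assms(1,2), of l j] root_value_less_iff[OF assms(3,4), of l' j] assms(5) by simp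
  then show ?thesis by (metis less_irrefl linorder_neqE_nat)
qed

lemma spectrum_param_inj:
  assumes "\<sigma> \<ge> 0"
  shows "inj (spectrum_param \<sigma>)"
proof (rule injI, clarify)
  fix m k m' k' assume "spectrum_param \<sigma> (m, k) = spectrum_param \<sigma> (m', k')"
  then have m: "m = m'" and "root_value (m + 2 * k) (robin_shift \<sigma> m k) = root_value (m' + 2 * k') (robin_shift \<sigma> m' k')"
    by (auto simp: spectrum_param_def)
  then have "m + 2 * k = m' + 2 * k'"
    using robin_shift_range[OF assms] by (intro root_value_level_unique) auto
  then show "m = m' \<and> k = k'" using m by simp
qed

text \<open>
  The eigenvalue with parameters \<open>(m, k)\<close> lies between the levels \<open>l (l + 1)\<close> and \<open>(l + 1) (l + 2)\<close> for
  \<open>l = m + 2 k\<close>, so the number of eigenvalues below a level is independent of \<open>\<sigma>\<close>.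
\<close>

lemma spectrum_below_level:
  assumes "\<sigma> \<ge> 0"
  shows "{p \<in> desym_spectrum \<sigma>. snd p < real l * (real l + 1)} = spectrum_param \<sigma> ` {(m, k). m + 2 * k < l}"
  using root_value_less_iff[OF robin_shift_range[OF assms]]
  unfolding desym_spectrum_eq[OF assms] by (auto simp: spectrum_param_def)

lemma finite_level: "finite {(m, k). m + 2 * k < (l :: nat)}"
  by (rule finite_subset[of _ "{..<l} \<times> {..<l}"]) auto

lemma finite_spectrum_below:
  assumes "\<sigma> \<ge> 0"
  shows "finite {p \<in> desym_spectrum \<sigma>. snd p < x}"
proof -
  obtain l :: nat where l: "x \<le> real l" using real_arch_simple by blast
  also have "\<dots> \<le> real l * (real l + 1)" by (simp add: algebra_simps)
  finally have "{p \<in> desym_spectrum \<sigma>. snd p < x} \<subseteq> {p \<in> desym_spectrum \<sigma>. snd p < real l * (real l + 1)}"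
    by auto
  then show ?thesis
    unfolding spectrum_below_level[OF assms] by (rule finite_subset) (intro finite_imageI finite_level)
qed

lemma ordered_spectrum_less_iff:
  assumes "\<sigma> \<ge> 0" "ordered_spectrum \<sigma> l"
  shows "l n < x \<longleftrightarrow> n < card {p \<in> desym_spectrum \<sigma>. snd p < x}"
proof -
  obtain s where "mono l" "bij_betw (\<lambda>n. (s n, l n)) UNIV (desym_spectrum \<sigma>)"
    using assms(2) unfolding ordered_spectrum_def by blast
  from sorted_enumeration_less_iff[OF this finite_spectrum_below[OF assms(1)]] show ?thesis .
qed

lemma robin_ev_ordered:
  assumes "\<sigma> \<ge> 0"
  shows "ordered_spectrum \<sigma> (robin_ev \<sigma>)"
proof -
  have "infinite (desym_spectrum \<sigma>)"
  proof -
    have "desym_spectrum \<sigma> = range (spectrum_param \<sigma>)"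
      unfolding desym_spectrum_eq[OF assms] spectrum_param_def ..
    moreover have "infinite (UNIV :: (nat \<times> nat) set)"
      by (simp add: finite_prod)
    ultimately show ?thesis using finite_imageD[OF _ spectrum_param_inj[OF assms]] by auto
  qed
  from exists_sorted_enumeration[OF this finite_spectrum_below[OF assms]]
  obtain l where l: "ordered_spectrum \<sigma> l"
    unfolding ordered_spectrum_def ..
  moreover have "l' = l" if "ordered_spectrum \<sigma> l'" for l'
  proof
    fix n
    have "l n < x \<longleftrightarrow> l' n < x" for x
      using ordered_spectrum_less_iff[OF assms l] ordered_spectrum_less_iff[OF assms that] by simp
    from this[of "l n"] this[of "l' n"] show "l' n = l n" by simp
  qed
  ultimately show ?thesis unfolding robin_ev_def by (rule theI)
qed

lemma robin_ev_less_level_iff: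
  assumes "\<sigma> \<ge> 0"
  shows "robin_ev \<sigma> n < real l * (real l + 1) \<longleftrightarrow> n < card {(m, k). m + 2 * k < l}"
proof -
  have "robin_ev \<sigma> n < real l * (real l + 1) \<longleftrightarrow> n < card {p \<in> desym_spectrum \<sigma>. snd p < real l * (real l + 1)}"
    by (rule ordered_spectrum_less_iff[OF assms robin_ev_ordered[OF assms]])
  also have "card {p \<in> desym_spectrum \<sigma>. snd p < real l * (real l + 1)} = card {(m, k). m + 2 * k < l}"
    unfolding spectrum_below_level[OF assms]
    by (rule card_image[OF inj_on_subset[OF spectrum_param_inj[OF assms]]]) simp
  finally show ?thesis .
qed

lemma robin_ev_root:
  assumes "\<sigma> \<ge> 0"
  shows "\<exists>m k. robin_ev \<sigma> n = root_value (m + 2 * k) (robin_shift \<sigma> m k)"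
proof -
  obtain s where "bij_betw (\<lambda>n. (s n, robin_ev \<sigma> n)) UNIV (desym_spectrum \<sigma>)"
    using robin_ev_ordered[OF assms] unfolding ordered_spectrum_def by blast
  then have "(s n, robin_ev \<sigma> n) \<in> desym_spectrum \<sigma>" unfolding bij_betw_def by blast
  then show ?thesis unfolding desym_spectrum_eq[OF assms] by auto
qed

lemma robin_ev_attains:
  assumes "\<sigma> \<ge> 0"
  shows "\<exists>n. robin_ev \<sigma> n = root_value (m + 2 * k) (robin_shift \<sigma> m k)"
proof -
  obtain s where "bij_betw (\<lambda>n. (s n, robin_ev \<sigma> n)) UNIV (desym_spectrum \<sigma>)"
    using robin_ev_ordered[OF assms] unfolding ordered_spectrum_def by blast
  moreover have "(m, root_value (m + 2 * k) (robin_shift \<sigma> m k)) \<in> desym_spectrum \<sigma>"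
    unfolding desym_spectrum_eq[OF assms] by (auto intro!: image_eqI[of _ _ "(m, k)"])
  ultimately have "(m, root_value (m + 2 * k) (robin_shift \<sigma> m k)) \<in> range (\<lambda>n. (s n, robin_ev \<sigma> n))"
    unfolding bij_betw_def by blast
  then obtain n where "(m, root_value (m + 2 * k) (robin_shift \<sigma> m k)) = (s n, robin_ev \<sigma> n)" by (rule imageE)
  then have "snd (m, root_value (m + 2 * k) (robin_shift \<sigma> m k)) = snd (s n, robin_ev \<sigma> n)" by (rule arg_cong)
  then have "robin_ev \<sigma> n = root_value (m + 2 * k) (robin_shift \<sigma> m k)" by (simp only: snd_conv)
  then show ?thesis ..
qed

text \<open>
  The counting functions for \<open>\<sigma>\<close> and \<open>0\<close> agree at all levels \<open>l (l + 1)\<close>, so an index cannot belong to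
  different clusters in the two spectra.
\<close>

lemma robin_ev_same_level:
  assumes "\<sigma> \<ge> 0" "robin_ev \<sigma> n = root_value l \<epsilon>" "0 \<le> \<epsilon>" "\<epsilon> < 1/2"
  shows "robin_ev 0 n = real l * (real l + 1)"
proof -
  obtain m k where mk: "robin_ev 0 n = root_value (m + 2 * k) (robin_shift 0 m k)"
    using robin_ev_root[of 0 n] by auto
  then have ev0: "robin_ev 0 n = root_value (m + 2 * k) 0" by (simp add: robin_shift_zero)
  have "l < l' \<longleftrightarrow> m + 2 * k < l'" for l'
    using robin_ev_less_level_iff[OF assms(1), of n l'] robin_ev_less_level_iff[of 0 n l']
      root_value_less_iff[OF assms(3,4), of l l'] root_value_less_iff[of 0 "m + 2 * k" l']
    by (simp add: assms(2) ev0)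
  then have "l = m + 2 * k" by (metis less_irrefl linorder_neqE_nat)
  then show ?thesis using ev0 by (simp add: root_value_zero)
qed

section \<open>The gaps\<close>

lemma gap_formula: "root_value l \<epsilon> - real l * (real l + 1) = 2 * \<epsilon> * (2 * real l + 1 + 2 * \<epsilon>)"
  by (simp add: root_value_def algebra_simps)

lemma level_quarter_power:
  assumes "l \<ge> 1"
  shows "sqrt (real l) \<le> (real l * (real l + 1)) powr (1/4)"
    "(real l * (real l + 1)) powr (1/4) \<le> sqrt (real l + 1)"
proof -
  have l: "real l \<ge> 1" using assms by simp
  have q: "sqrt x = (x * x) powr (1/4)" if "x > 0" for x :: real
  proof -
    have "(x * x) powr (1/4) = x powr (1/4 + 1/4)"
      unfolding powr_add using that by (intro powr_mult)
    then show ?thesis using powr_half_sqrt[of x] that by simp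
  qed
  show "sqrt (real l) \<le> (real l * (real l + 1)) powr (1/4)"
    unfolding q[of "real l", OF order.strict_trans2[OF zero_less_one l]] using l
    by (intro powr_mono2 mult_left_mono) auto
  have "real l + 1 > 0" by linarith
  from q[OF this] show "(real l * (real l + 1)) powr (1/4) \<le> sqrt (real l + 1)"
    by (simp only:) (intro powr_mono2 mult_right_mono, auto)
qed

text \<open>
  At \<open>n = 0\<close> the right side would vanish, as \<open>robin_ev 0 0 = 0\<close>. For \<open>n \<ge> 1\<close> the cluster has
  \<open>l \<ge> 1\<close>, so the gap is at most \<open>8 l \<epsilon>\<close> and \<open>robin_shift_upper\<close> applies.
\<close>

lemma gap_upper:
  assumes "\<sigma> \<ge> 0" "n \<ge> 1"
  shows "robin_ev \<sigma> n - robin_ev 0 n \<le> 4 * robin_ev 0 n powr (1/4) * \<sigma>"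
proof -
  obtain m k where mk: "robin_ev \<sigma> n = root_value (m + 2 * k) (robin_shift \<sigma> m k)"
    using robin_ev_root[OF assms(1)] by blast
  define l where "l = m + 2 * k"
  define \<epsilon> where "\<epsilon> = robin_shift \<sigma> m k"
  have e: "0 \<le> \<epsilon>" "\<epsilon> < 1/2" using robin_shift_range[OF assms(1)] by (auto simp: \<epsilon>_def)
  have ev0: "robin_ev 0 n = real l * (real l + 1)"
    using robin_ev_same_level[OF assms(1) mk] robin_shift_range[OF assms(1)] by (simp add: l_def)
  have l1: "l \<ge> 1"
  proof (rule ccontr)
    assume "\<not> l \<ge> 1"
    then have "l = 0" by simp
    then have "robin_ev 0 n < real 1 * (real 1 + 1)" using ev0 by simp
    then have "n < card {(m, k). m + 2 * k < (1 :: nat)}" using robin_ev_less_level_iff[of 0 n 1] by simp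
    also have "{(m, k). m + 2 * k < (1 :: nat)} = {(0, 0)}" by auto
    finally show False using assms(2) by simp
  qed
  have shift: "2 * \<epsilon> * sqrt (real l) \<le> \<sigma>"
    using robin_shift_upper[of \<sigma> m k] assms l1 by (simp add: \<epsilon>_def l_def)
  have "robin_ev \<sigma> n - robin_ev 0 n = 2 * \<epsilon> * (2 * real l + 1 + 2 * \<epsilon>)"
    unfolding mk ev0 l_def[symmetric] \<epsilon>_def[symmetric] by (rule gap_formula)
  also have "\<dots> \<le> 2 * \<epsilon> * (4 * real l)"
    using e l1 by (intro mult_left_mono) auto
  also have "\<dots> = 4 * sqrt (real l) * (2 * \<epsilon> * sqrt (real l))" by simp
  also have "\<dots> \<le> 4 * sqrt (real l) * \<sigma>" using shift by (intro mult_left_mono) auto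
  also have "\<dots> \<le> 4 * robin_ev 0 n powr (1/4) * \<sigma>"
    using level_quarter_power(1)[OF l1] assms(1) unfolding ev0 by (intro mult_right_mono) auto
  finally show ?thesis .
qed

text \<open>
  The index \<open>n\<close> is that of the lowest eigenvalue of the sector \<open>m = l\<close>, with \<open>l\<close> so large that
  \<open>robin_shift_lower\<close> applies and that the eigenvalue exceeds the one with index \<open>N\<close>.
\<close>

lemma gap_lower:
  assumes "\<sigma> \<ge> 0"
  shows "\<exists>n\<ge>N. robin_ev \<sigma> n - robin_ev 0 n \<ge> 1/16 * robin_ev 0 n powr (1/4) * \<sigma>"
proof -
  obtain l :: nat where l: "4 * \<sigma>\<^sup>2 + \<bar>robin_ev \<sigma> N\<bar> + 1 \<le> real l" using real_arch_simple by blast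
  have l1: "real l \<ge> 1" "real l \<ge> 4 * \<sigma>\<^sup>2" "real l > robin_ev \<sigma> N"
    using l zero_le_power2[of \<sigma>] by linarith+
  define \<epsilon> where "\<epsilon> = robin_shift \<sigma> l 0"
  have e: "0 \<le> \<epsilon>" "\<epsilon> < 1/2" using robin_shift_range[OF assms(1)] by (auto simp: \<epsilon>_def)
  obtain n where n: "robin_ev \<sigma> n = root_value l \<epsilon>"
    using robin_ev_attains[OF assms, of l 0] by (auto simp: \<epsilon>_def)
  have ev0: "robin_ev 0 n = real l * (real l + 1)"
    by (rule robin_ev_same_level[OF assms n e])
  have "robin_ev \<sigma> N < real l * (real l + 1)"
  proof -
    have "real l \<le> real l * (real l + 1)" by (simp add: algebra_simps)
    then show ?thesis using l1 by linarith
  qed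
  also have "\<dots> \<le> robin_ev \<sigma> n" unfolding n by (rule root_value_bounds(1)[OF e])
  finally have "N \<le> n"
    using robin_ev_ordered[OF assms] unfolding ordered_spectrum_def mono_def by (meson le_cases not_less)
  moreover have "robin_ev \<sigma> n - robin_ev 0 n \<ge> 1/16 * robin_ev 0 n powr (1/4) * \<sigma>"
  proof -
    have "\<sigma> \<le> 4 * pi * \<epsilon> * sqrt (real l + 1)"
      using robin_shift_lower[OF assms] l1 by (simp add: \<epsilon>_def)
    also have "\<dots> \<le> 4 * 4 * \<epsilon> * sqrt (real l + 1)"
      using e pi_less_4 by (intro mult_right_mono) auto
    finally have s: "\<sigma> \<le> 16 * \<epsilon> * sqrt (real l + 1)" by simp
    have "1/16 * robin_ev 0 n powr (1/4) * \<sigma> \<le> 1/16 * sqrt (real l + 1) * (16 * \<epsilon> * sqrt (real l + 1))"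
      using level_quarter_power(2)[of l] l1 s assms unfolding ev0 by (intro mult_mono) auto
    also have "\<dots> = \<epsilon> * (real l + 1)" by simp
    also have "\<dots> \<le> \<epsilon> * (2 * (2 * real l + 1 + 2 * \<epsilon>))" using e by (intro mult_left_mono) auto
    also have "\<dots> = robin_ev \<sigma> n - robin_ev 0 n"
      unfolding n ev0 gap_formula by simp
    finally show ?thesis .
  qed
  ultimately show ?thesis by blast
qed

theorem theorem1p3:
  "\<exists>c C :: real. 0 < c \<and> c < C \<and>
     (\<forall>\<sigma> :: real. \<sigma> > 0 \<longrightarrow>
        (\<forall>n :: nat. n \<ge> 1 \<longrightarrow>
           robin_ev \<sigma> n - robin_ev 0 n \<le> C * robin_ev 0 n powr (1/4) * \<sigma>) \<and>
        (\<forall>N :: nat. \<exists>n \<ge> N.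
           robin_ev \<sigma> n - robin_ev 0 n \<ge> c * robin_ev 0 n powr (1/4) * \<sigma>))"
proof (rule exI[of _ "1/16"], rule exI[of _ 4], intro conjI allI impI)
  show "0 < (1/16 :: real)" "(1/16 :: real) < 4" by simp_all
  show "robin_ev \<sigma> n - robin_ev 0 n \<le> 4 * robin_ev 0 n powr (1/4) * \<sigma>" if "\<sigma> > 0" "n \<ge> 1" for \<sigma> n
    using that by (intro gap_upper) auto
  show "\<exists>n\<ge>N. robin_ev \<sigma> n - robin_ev 0 n \<ge> 1/16 * robin_ev 0 n powr (1/4) * \<sigma>" if "\<sigma> > 0" for \<sigma> N
    using that by (intro gap_lower) auto
qed

end
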